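(* Let $a:\mathbb{R}\to\mathbb{R}$ be continuous and non-decreasing, and suppose there is a constant $\sigma>0$ with $\sigma\le a(t)$ for all $t\in\mathbb{R}$. Let $\lambda>0$, $b>0$ and let $j\ge1$ be an integer. Then a positive and nontrivial solution of the problem $$-a(\|u_x\|_j^2)\,u_{xx}=\lambda u-bu^3,\quad x\in\left(0,\tfrac{\pi}{j}\right);\qquad u(0)=u\left(\tfrac{\pi}{j}\right)=0$$ is unique, i.e. there is at most one such solution.
   Context: $\|u_x\|_j^2=\int_0^{\pi/j}|u_x(x)|^2dx$. Solutions are weak solutions: $u\in H^1_0(0,\frac{\pi}{j})$ with $$a(\|u_x\|_j^2)\int_0^{\pi/j}u_x v_x\,dx+\int_0^{\pi/j}(-\lambda u+bu^3)v\,dx=0\quad\text{for all }v\in H^1_0(0,\tfrac{\pi}{j}).$$ Positive means $u\ge0$ a.e.; nontrivial means $u\not\equiv0$. *)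

theory Defs
  imports "HOL-Analysis.Analysis"
begin

text \<open>
  Elements of \<open>L\<^sup>2(S)\<close> and of the Sobolev spaces below are represented by functions
  \<open>real \<Rightarrow> real\<close>. Their values outside \<open>S\<close> and on null sets are irrelevant, so equality
  of two elements means equality almost everywhere on \<open>S\<close>.
\<close>

definition test_functions :: "real set \<Rightarrow> (real \<Rightarrow> real) set" where
  "test_functions S =
    {\<phi>. (\<forall>n x. (deriv ^^ n) \<phi> field_differentiable at x) \<and>
         (\<exists>K. compact K \<and> K \<subseteq> S \<and> (\<forall>x. x \<notin> K \<longrightarrow> \<phi> x = 0))}"

definition L2_space :: "real set \<Rightarrow> (real \<Rightarrow> real) set" where
  "L2_space S =
    {u. u \<in> borel_measurable (lebesgue_on S) \<and> integrable (lebesgue_on S) (\<lambda>x. (u x)\<^sup>2)}"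

definition has_weak_deriv :: "real set \<Rightarrow> (real \<Rightarrow> real) \<Rightarrow> (real \<Rightarrow> real) \<Rightarrow> bool" where
  "has_weak_deriv S u g \<longleftrightarrow>
    (\<forall>\<phi>\<in>test_functions S.
      (\<integral>x. u x * deriv \<phi> x \<partial>lebesgue_on S) = - (\<integral>x. g x * \<phi> x \<partial>lebesgue_on S))"

definition H1_space :: "real set \<Rightarrow> (real \<Rightarrow> real) set" where
  "H1_space S = {u \<in> L2_space S. \<exists>g\<in>L2_space S. has_weak_deriv S u g}"

text \<open>
  For \<open>u\<close> in \<open>H\<^sup>1(S)\<close> with \<open>S\<close> open, the weak derivative is determined up to null sets,
  so the integrals in which it occurs do not depend on the choice of representative.
\<close>

definition weak_deriv :: "real set \<Rightarrow> (real \<Rightarrow> real) \<Rightarrow> real \<Rightarrow> real" where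
  "weak_deriv S u = (SOME g. g \<in> L2_space S \<and> has_weak_deriv S u g)"

text \<open>The closure of the test functions in the norm of \<open>H\<^sup>1(S)\<close>:\<close>

definition H10_space :: "real set \<Rightarrow> (real \<Rightarrow> real) set" where
  "H10_space S =
    {u \<in> H1_space S. \<exists>\<phi> :: nat \<Rightarrow> real \<Rightarrow> real.
       (\<forall>n. \<phi> n \<in> test_functions S) \<and>
       (\<lambda>n. (\<integral>x. (\<phi> n x - u x)\<^sup>2 \<partial>lebesgue_on S)
           + (\<integral>x. (deriv (\<phi> n) x - weak_deriv S u x)\<^sup>2 \<partial>lebesgue_on S)) \<longlonglongrightarrow> 0}"

definition deriv_norm_sq :: "real set \<Rightarrow> (real \<Rightarrow> real) \<Rightarrow> real" where
  "deriv_norm_sq S u = (\<integral>x. (weak_deriv S u x)\<^sup>2 \<partial>lebesgue_on S)"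

text \<open>
  Weak solutions of \<open>- a(\<parallel>u\<^sub>x\<parallel>\<^sup>2) u\<^sub>x\<^sub>x = l u - b u\<^sup>3\<close> on \<open>S\<close>; the homogeneous Dirichlet
  conditions are encoded in the membership in \<open>H\<^sup>1\<^sub>0(S)\<close>.
\<close>

definition weak_solution ::
  "real set \<Rightarrow> (real \<Rightarrow> real) \<Rightarrow> real \<Rightarrow> real \<Rightarrow> (real \<Rightarrow> real) \<Rightarrow> bool" where
  "weak_solution S a l b u \<longleftrightarrow>
    u \<in> H10_space S \<and>
    (\<forall>v\<in>H10_space S.
      a (deriv_norm_sq S u) * (\<integral>x. weak_deriv S u x * weak_deriv S v x \<partial>lebesgue_on S)
      + (\<integral>x. (- l * u x + b * (u x) ^ 3) * v x \<partial>lebesgue_on S) = 0)"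

definition positive_fun :: "real set \<Rightarrow> (real \<Rightarrow> real) \<Rightarrow> bool" where
  "positive_fun S u \<longleftrightarrow> (AE x in lebesgue_on S. u x \<ge> 0)"

definition nontrivial_fun :: "real set \<Rightarrow> (real \<Rightarrow> real) \<Rightarrow> bool" where
  "nontrivial_fun S u \<longleftrightarrow> \<not> (AE x in lebesgue_on S. u x = 0)"

end

theory Submission
  imports Defs
begin

text \<open>
  Testing with smooth functions and du Bois-Reymond's lemma show that a weak solution is \<open>C\<^sup>2\<close>
  up to the end points, and a nonnegative nontrivial one is positive in the interior because a
  zero there would be a double zero of a linear second order equation. Write
  \<open>m = \<parallel>u\<^sub>x\<parallel>\<^sup>2\<close> and \<open>n = \<parallel>v\<^sub>x\<parallel>\<^sup>2\<close>. Picone's inequality \<open>\<integral> u\<^sub>x (v\<^sup>2 / u)\<^sub>x \<le> n\<close> gives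
  \<open>a(m) (m - n) \<le> \<integral> (l - b u\<^sup>2) (u\<^sup>2 - v\<^sup>2)\<close>. Adding the same inequality with \<open>u\<close> and \<open>v\<close>
  exchanged yields \<open>(a(m) - a(n)) (m - n) \<le> - b \<integral> (u\<^sup>2 - v\<^sup>2)\<^sup>2\<close>, whose left-hand side is
  nonnegative since \<open>a\<close> is non-decreasing.
\<close>

subsection \<open>Smooth functions\<close>

text \<open>The nonlocal coefficient is a positive constant once a solution is fixed: with A = a(m)
  the equation reads -u'' = r u with the continuous coefficient r = (l - b u^2) / A, so linear
  theory applies to each solution separately. Two solutions may have different constants A, which is
  why subtracting their equations is of little use and they are compared through their energies
  instead. Testing the equation with u gives A m = \<integral> (l - b u^2) u^2, Picone's inequality
  gives A n \<ge> \<integral> (l - b u^2) v^2, and the difference is the inequality for a(m) (m -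
  n). When the two inequalities are added, the constant l cancels and only -b (u^2 - v^2)^2 remains;
  hence u^2 = v^2, and positivity settles the sign. Regularity has to precede all this: the weak
  derivative is a choice determined only up to null sets, whereas v^2 / u calls for pointwise
  values, a nonzero denominator and control at the end points.\<close>

primrec ndiff :: "nat \<Rightarrow> (real \<Rightarrow> real) \<Rightarrow> bool" where
  "ndiff 0 f = True"
| "ndiff (Suc n) f = (\<exists>f'. (\<forall>x. (f has_real_derivative f' x) (at x)) \<and> ndiff n f')"

text \<open>Quantifying the derivative existentially at every level makes the closure properties
  plain inductions with explicit witnesses, without computing iterates of \<open>deriv\<close>. The
  form used in \<open>test_functions\<close> is recovered in
  \<open>smooth_iff_funpow\<close>.\<close>

definition smooth :: "(real \<Rightarrow> real) \<Rightarrow> bool" where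
  "smooth f \<longleftrightarrow> (\<forall>n. ndiff n f)"

lemma ndiff_SucD: "ndiff (Suc n) f \<Longrightarrow> ndiff n f"
  by (induction n arbitrary: f) auto

lemma smooth_iff_deriv: "smooth f \<longleftrightarrow> (\<forall>x. (f has_real_derivative deriv f x) (at x)) \<and> smooth (deriv f)"
proof -
  have *: "f' = deriv f" if "\<forall>x. (f has_real_derivative f' x) (at x)" for f'
    using that by (auto intro!: ext DERIV_imp_deriv[symmetric])
  have "smooth f \<longleftrightarrow> (\<forall>n. ndiff (Suc n) f)"
    unfolding smooth_def using ndiff_SucD by blast
  also have "\<dots> \<longleftrightarrow> (\<forall>x. (f has_real_derivative deriv f x) (at x)) \<and> smooth (deriv f)"
    unfolding smooth_def ndiff.simps by (metis *)
  finally show ?thesis .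
qed

lemma smooth_has_deriv: "smooth f \<Longrightarrow> (f has_real_derivative deriv f x) (at x)"
  using smooth_iff_deriv by blast

lemma smooth_deriv: "smooth f \<Longrightarrow> smooth (deriv f)"
  using smooth_iff_deriv by blast

lemma smooth_antideriv:
  assumes "\<And>x. (F has_real_derivative f x) (at x)" "smooth f"
  shows "smooth F"
proof -
  have "deriv F = f" using assms(1) DERIV_imp_deriv by blast
  then show ?thesis using smooth_iff_deriv[of F] assms by simp
qed

lemma smooth_continuous: "smooth f \<Longrightarrow> continuous_on A f"
  by (meson DERIV_isCont continuous_at_imp_continuous_on smooth_has_deriv)

lemma smooth_iff_funpow: "smooth f \<longleftrightarrow> (\<forall>n x. (deriv ^^ n) f field_differentiable at x)"
proof
  assume "smooth f"
  moreover have "smooth ((deriv ^^ n) f)" if "smooth f" for n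
    using that by (induction n) (auto intro: smooth_deriv)
  ultimately show "\<forall>n x. (deriv ^^ n) f field_differentiable at x"
    using smooth_has_deriv field_differentiable_def by blast
next
  assume "\<forall>n x. (deriv ^^ n) f field_differentiable at x"
  then have "ndiff n f" for n
  proof (induction n arbitrary: f)
    case (Suc n)
    have "ndiff n (deriv f)"
      using Suc.prems by (intro Suc.IH) (metis comp_apply funpow_Suc_right)
    moreover have "(f has_real_derivative deriv f x) (at x)" for x
      using Suc.prems[rule_format, of 0] by (simp add: field_differentiable_derivI)
    ultimately show ?case by auto
  qed auto
  then show "smooth f" by (simp add: smooth_def)
qed

lemma ndiff_const: "ndiff n (\<lambda>x. c)"
  by (induction n arbitrary: c) (auto intro!: exI[of _ "\<lambda>x. 0"])

lemma ndiff_add: "ndiff n f \<Longrightarrow> ndiff n g \<Longrightarrow> ndiff n (\<lambda>x. f x + g x)"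
proof (induction n arbitrary: f g)
  case (Suc n)
  then obtain f' g' where
    "\<forall>x. (f has_real_derivative f' x) (at x)" "\<forall>x. (g has_real_derivative g' x) (at x)"
    "ndiff n f'" "ndiff n g'" by auto
  then show ?case
    using Suc.IH by (auto intro!: exI[of _ "\<lambda>x. f' x + g' x"] derivative_eq_intros)
qed auto

lemma ndiff_mult: "ndiff n f \<Longrightarrow> ndiff n g \<Longrightarrow> ndiff n (\<lambda>x. f x * g x)"
proof (induction n arbitrary: f g)
  case (Suc n)
  then obtain f' g' where
    d: "\<And>x. (f has_real_derivative f' x) (at x)" "\<And>x. (g has_real_derivative g' x) (at x)"
    "ndiff n f'" "ndiff n g'" by auto
  have "((\<lambda>x. f x * g x) has_real_derivative f' x * g x + g' x * f x) (at x)" for x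
    by (rule DERIV_mult[OF d(1,2)])
  moreover have "ndiff n (\<lambda>x. f' x * g x + g' x * f x)"
    by (intro ndiff_add Suc.IH d(3,4)) (use Suc.prems ndiff_SucD in blast)+
  ultimately show ?case by (auto intro!: exI[of _ "\<lambda>x. f' x * g x + g' x * f x"])
qed auto

text \<open>The derivative of 1/f is -f' (1/f)^2, a product of f' and 1/f itself, so the induction
  closes for a fixed f.\<close>

lemma ndiff_inverse:
  assumes "\<And>x. f x \<noteq> 0"
  shows "ndiff n f \<Longrightarrow> ndiff n (\<lambda>x. inverse (f x))"
proof (induction n)
  case (Suc n)
  then obtain f' where d: "\<And>x. (f has_real_derivative f' x) (at x)" "ndiff n f'" by auto
  let ?g = "\<lambda>x. inverse (f x)"
  have "(?g has_real_derivative - 1 * f' x * (?g x * ?g x)) (at x)" for x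
    using DERIV_inverse_fun[OF d(1) assms, of x] by (simp add: mult.commute)
  moreover have "ndiff n (\<lambda>x. - 1 * f' x * (?g x * ?g x))"
    by (intro ndiff_mult Suc.IH d ndiff_const ndiff_SucD[OF Suc.prems])
  ultimately show ?case by (auto intro!: exI[of _ "\<lambda>x. - 1 * f' x * (?g x * ?g x)"])
qed auto

lemma ndiff_affine: "ndiff n f \<Longrightarrow> ndiff n (\<lambda>x. f (c * x + d))"
proof (induction n arbitrary: f)
  case (Suc n)
  then obtain f' where d: "\<And>x. (f has_real_derivative f' x) (at x)" "ndiff n f'" by auto
  have "((\<lambda>x. f (c * x + d)) has_real_derivative f' (c * x + d) * c) (at x)" for x
    by (rule DERIV_chain2[OF d(1)]) (auto intro!: derivative_eq_intros)
  moreover have "ndiff n (\<lambda>x. f' (c * x + d) * c)"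
    by (rule ndiff_mult[OF Suc.IH[OF d(2)] ndiff_const])
  ultimately show ?case by (auto intro!: exI[of _ "\<lambda>x. f' (c * x + d) * c"])
qed auto

lemma smooth_const: "smooth (\<lambda>x. c)"
  and smooth_add: "smooth f \<Longrightarrow> smooth g \<Longrightarrow> smooth (\<lambda>x. f x + g x)"
  and smooth_mult: "smooth f \<Longrightarrow> smooth g \<Longrightarrow> smooth (\<lambda>x. f x * g x)"
  and smooth_affine: "smooth f \<Longrightarrow> smooth (\<lambda>x. f (c * x + d))"
  by (simp_all add: smooth_def ndiff_const ndiff_add ndiff_mult ndiff_affine)

lemma smooth_diff: "smooth f \<Longrightarrow> smooth g \<Longrightarrow> smooth (\<lambda>x. f x - g x)"
  using smooth_add[OF _ smooth_mult[OF smooth_const[of "-1"]], of f g] by simp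

lemma smooth_divide:
  assumes "smooth f" "smooth g" "\<And>x. g x \<noteq> 0"
  shows "smooth (\<lambda>x. f x / g x)"
  unfolding divide_inverse
  using assms by (simp add: smooth_def ndiff_mult ndiff_inverse)

section \<open>Compactly supported smooth functions from exp(-1/x)\<close>

definition flat_exp :: "nat \<Rightarrow> real \<Rightarrow> real" where
  "flat_exp k x = (if x > 0 then (1 / x) ^ k * exp (- 1 / x) else 0)"

text \<open>From the right, the substitution y = 1/x turns this into y^k / exp y
  \<longlongrightarrow> 0 at infinity; from the left the function is zero.\<close>

lemma flat_exp_tendsto_0: "(flat_exp k \<longlongrightarrow> 0) (at 0)"
proof -
  have "((\<lambda>x::real. (inverse x) ^ k / exp (inverse x)) \<longlongrightarrow> 0) (at_right 0)"
    using tendsto_power_div_exp_0[of k] filterlim_inverse_at_top_right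
    by (rule filterlim_compose)
  then have "(flat_exp k \<longlongrightarrow> 0) (at_right 0)"
    by (rule Lim_transform_eventually)
       (auto simp: eventually_at_filter flat_exp_def exp_minus field_simps)
  moreover have "(flat_exp k \<longlongrightarrow> 0) (at_left 0)"
    by (rule Lim_transform_eventually[of "\<lambda>x. 0"])
       (auto simp: eventually_at_filter flat_exp_def)
  ultimately show ?thesis by (simp add: filterlim_split_at)
qed

text \<open>The parameter \<open>k\<close> exists for this formula: the derivative is a linear
  combination of members of the same family, so a single induction over all \<open>k\<close> at once
  gives smoothness of every \<open>flat_exp k\<close>.\<close>

lemma flat_exp_has_deriv:
  "(flat_exp k has_real_derivative - real k * flat_exp (Suc k) x + flat_exp (Suc (Suc k)) x) (at x)"
proof -
  consider "x > 0" | "x < 0" | "x = 0" by linarith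
  then show ?thesis
  proof cases
    case 1
    have "((\<lambda>x. (1 / x) ^ k * exp (- 1 / x)) has_real_derivative
        - real k * flat_exp (Suc k) x + flat_exp (Suc (Suc k)) x) (at x)"
      using 1 by (cases k) (auto simp: flat_exp_def field_simps intro!: derivative_eq_intros,
          metis One_nat_def power_eq_if)
    then show ?thesis
      by (rule DERIV_cong_ev[OF refl _ refl, THEN iffD1, rotated])
         (use 1 in \<open>auto simp: flat_exp_def intro!: eventually_mono[OF eventually_nhds_in_open[of "{0<..}"]]\<close>)
  next
    case 2
    have "((\<lambda>x. 0) has_real_derivative
        - real k * flat_exp (Suc k) x + flat_exp (Suc (Suc k)) x) (at x)"
      using 2 by (simp add: flat_exp_def)
    then show ?thesis
      by (rule DERIV_cong_ev[OF refl _ refl, THEN iffD1, rotated])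
         (use 2 in \<open>auto simp: flat_exp_def intro!: eventually_mono[OF eventually_nhds_in_open[of "{..<0}"]]\<close>)
  next
    case 3
    \<comment> \<open>The difference quotient of \<open>flat_exp k\<close> at 0 is exactly
      \<open>flat_exp (Suc k)\<close>, which tends to 0.\<close>
    have "((\<lambda>h. (flat_exp k (0 + h) - flat_exp k 0) / h) \<longlongrightarrow> 0) (at 0)"
      by (rule Lim_transform_eventually[OF flat_exp_tendsto_0[of "Suc k"]])
         (auto simp: eventually_at_filter flat_exp_def)
    then show ?thesis using 3 by (simp add: DERIV_def flat_exp_def)
  qed
qed

lemma smooth_flat_exp: "smooth (flat_exp k)"
proof -
  have "ndiff n (flat_exp k)" for n
  proof (induction n arbitrary: k)
    case (Suc n)
    let ?f' = "\<lambda>x. - real k * flat_exp (Suc k) x + flat_exp (Suc (Suc k)) x"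
    have "ndiff n ?f'"
      by (intro ndiff_add ndiff_mult ndiff_const Suc.IH)
    then show ?case
      unfolding ndiff.simps using flat_exp_has_deriv by (intro exI[of _ ?f']) blast
  qed auto
  then show ?thesis by (simp add: smooth_def)
qed

text \<open>For d \<le> c this is identically zero; the cutoffs below rely on that when shrinking an
  interval empties it.\<close>

definition bump :: "real \<Rightarrow> real \<Rightarrow> real \<Rightarrow> real" where
  "bump c d x = flat_exp 0 (x - c) * flat_exp 0 (d - x)"

lemma smooth_bump: "smooth (bump c d)"
proof -
  have "smooth (\<lambda>x. flat_exp 0 (1 * x + - c) * flat_exp 0 (- 1 * x + d))"
    by (rule smooth_mult[OF smooth_affine smooth_affine]; rule smooth_flat_exp)
  then show ?thesis by (simp add: bump_def[abs_def] algebra_simps)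
qed

lemma bump_pos: "c < x \<Longrightarrow> x < d \<Longrightarrow> bump c d x > 0"
  and bump_eq_0: "x \<le> c \<or> d \<le> x \<Longrightarrow> bump c d x = 0"
  and bump_nonneg: "bump c d x \<ge> 0"
  by (auto simp: bump_def flat_exp_def)

lemma test_functions_iff:
  "\<phi> \<in> test_functions S \<longleftrightarrow> smooth \<phi> \<and> (\<exists>K. compact K \<and> K \<subseteq> S \<and> (\<forall>x. x \<notin> K \<longrightarrow> \<phi> x = 0))"
  by (simp add: test_functions_def smooth_iff_funpow)

lemma test_functions_Ioo:
  assumes "p < q"
  shows "\<phi> \<in> test_functions {p<..<q} \<longleftrightarrow>
    smooth \<phi> \<and> (\<exists>c d. p < c \<and> d < q \<and> c \<le> d \<and> (\<forall>x. x \<notin> {c..d} \<longrightarrow> \<phi> x = 0))"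
proof -
  have "\<exists>c d. p < c \<and> d < q \<and> c \<le> d \<and> K \<subseteq> {c..d}" if K: "compact K" "K \<subseteq> {p<..<q}" for K :: "real set"
  proof (cases "K = {}")
    case True
    then show ?thesis using dense[OF assms] by auto
  next
    case False
    obtain c where "c \<in> K" "\<And>x. x \<in> K \<Longrightarrow> c \<le> x"
      using compact_attains_inf[OF K(1) False] by blast
    moreover obtain d where "d \<in> K" "\<And>x. x \<in> K \<Longrightarrow> x \<le> d"
      using compact_attains_sup[OF K(1) False] by blast
    ultimately show ?thesis
      using K(2) by (intro exI[of _ c] exI[of _ d]) auto
  qed
  moreover have "compact {c..d} \<and> {c..d} \<subseteq> {p<..<q}" if "p < c" "d < q" for c d :: real
    using that by auto
  ultimately show ?thesis
    unfolding test_functions_iff by (meson subsetD)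
qed

subsection \<open>The fundamental lemma of the calculus of variations\<close>

lemma L2_space_mult_integrable:
  assumes "f \<in> L2_space S" "g \<in> L2_space S"
  shows "integrable (lebesgue_on S) (\<lambda>x. f x * g x)"
proof (rule Bochner_Integration.integrable_bound)
  show "integrable (lebesgue_on S) (\<lambda>x. (f x)\<^sup>2 + (g x)\<^sup>2)"
    using assms by (auto simp: L2_space_def)
  show "(\<lambda>x. f x * g x) \<in> borel_measurable (lebesgue_on S)"
    using assms by (auto simp: L2_space_def)
  have "\<bar>s * t\<bar> \<le> s\<^sup>2 + t\<^sup>2" for s t :: real
  proof -
    have "2 * (\<bar>s\<bar> * \<bar>t\<bar>) \<le> s\<^sup>2 + t\<^sup>2"
      using sum_squares_bound[of "\<bar>s\<bar>" "\<bar>t\<bar>"] by (simp add: mult.assoc)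
    moreover have "0 \<le> \<bar>s\<bar> * \<bar>t\<bar>" by simp
    ultimately show ?thesis unfolding abs_mult by linarith
  qed
  then show "AE x in lebesgue_on S. norm (f x * g x) \<le> norm ((f x)\<^sup>2 + (g x)\<^sup>2)"
    by simp
qed

lemma L2_space_add:
  assumes "f \<in> L2_space S" "g \<in> L2_space S"
  shows "(\<lambda>x. f x + g x) \<in> L2_space S"
proof -
  have "integrable (lebesgue_on S) (\<lambda>x. (f x)\<^sup>2 + (g x)\<^sup>2 + 2 * (f x * g x))"
    using assms L2_space_mult_integrable[OF assms] by (auto simp: L2_space_def)
  then show ?thesis
    using assms by (auto simp: L2_space_def power2_sum mult.assoc)
qed

lemma L2_space_cmult: "f \<in> L2_space S \<Longrightarrow> (\<lambda>x. c * f x) \<in> L2_space S"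
  by (auto simp: L2_space_def power_mult_distrib)

lemma L2_space_diff:
  "f \<in> L2_space S \<Longrightarrow> g \<in> L2_space S \<Longrightarrow> (\<lambda>x. f x - g x) \<in> L2_space S"
  using L2_space_add[OF _ L2_space_cmult[of g S "-1"], of f] by simp

lemma integrable_Ioo:
  fixes f :: "real \<Rightarrow> real"
  assumes "continuous_on {p..q} f"
  shows "integrable (lebesgue_on {p<..<q}) f"
proof -
  have "f absolutely_integrable_on {p..q}"
    by (rule absolutely_integrable_continuous_real[OF assms])
  then have "f absolutely_integrable_on {p<..<q}"
    using absolutely_integrable_on_open_interval[where f = f and a = p and b = q] by simp
  then show ?thesis by (rule absolutely_integrable_imp_integrable) simp
qed

text \<open>The weak formulation uses Lebesgue integrals over the open interval, classical calculus
  uses the gauge integral over the closed one. This is the passage between them for integrands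
  continuous up to the end points.\<close>

lemma integral_Ioo:
  fixes f :: "real \<Rightarrow> real"
  assumes "continuous_on {p..q} f"
  shows "integral\<^sup>L (lebesgue_on {p<..<q}) f = integral {p..q} f"
  using lebesgue_integral_eq_integral[OF integrable_Ioo[OF assms]]
  by (simp add: integral_open_interval_real)

lemma L2_space_continuous: "continuous_on {p..q} f \<Longrightarrow> f \<in> L2_space {p<..<q}"
  by (auto simp: L2_space_def intro!: borel_measurable_integrable integrable_Ioo continuous_intros)

lemma L2_space_integrable: "f \<in> L2_space {p<..<q} \<Longrightarrow> integrable (lebesgue_on {p<..<q}) f"
  using L2_space_mult_integrable[of f "{p<..<q}" "\<lambda>x. 1"] L2_space_continuous[of p q "\<lambda>x. 1"] by simp

lemma integral_by_parts_vanishing: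
  fixes f g :: "real \<Rightarrow> real"
  assumes "p \<le> q"
    and f: "\<And>x. x \<in> {p..q} \<Longrightarrow> (f has_real_derivative f' x) (at x within {p..q})"
    and g: "\<And>x. x \<in> {p..q} \<Longrightarrow> (g has_real_derivative g' x) (at x within {p..q})"
    and cont: "continuous_on {p..q} f'" "continuous_on {p..q} g'"
    and 0: "f p * g p = 0" "f q * g q = 0"
  shows "integral {p..q} (\<lambda>x. f x * g' x) = - integral {p..q} (\<lambda>x. f' x * g x)"
proof -
  have cf: "continuous_on {p..q} f" "continuous_on {p..q} g"
    using f g by (blast intro: DERIV_continuous_on)+
  have "((\<lambda>x. f x * g' x + f' x * g x) has_integral f q * g q - f p * g p) {p..q}"
    using assms(1) by (intro fundamental_theorem_of_calculus)
      (auto simp flip: has_real_derivative_iff_has_vector_derivative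
        intro!: derivative_eq_intros f g)
  then have "integral {p..q} (\<lambda>x. f x * g' x + f' x * g x) = 0"
    using 0 by (simp add: integral_unique)
  moreover have "integral {p..q} (\<lambda>x. f x * g' x + f' x * g x)
      = integral {p..q} (\<lambda>x. f x * g' x) + integral {p..q} (\<lambda>x. f' x * g x)"
    by (intro Henstock_Kurzweil_Integration.integral_add integrable_continuous_real continuous_intros cf cont)
  ultimately show ?thesis by simp
qed

text \<open>The quotient t / (t + 1/n) tends to 1 for t > 0 and is 0 at t = 0, so applied to a bump
  it approximates an indicator by smooth functions without convolution. Shrinking the interval by
  1/n on both sides keeps the support compact in the open interval even when \<open>a = p\<close> or
  \<open>b = q\<close>.\<close>

lemma cutoff_test_function:
  assumes "n > 0" "p \<le> a" "b \<le> q"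
  defines "B \<equiv> bump (a + 1 / n) (b - 1 / n)"
  shows "(\<lambda>x. B x / (B x + 1 / n)) \<in> test_functions {p<..<q}"
proof -
  have "B x + 1 / n > 0" for x
    using assms bump_nonneg by (simp add: add_nonneg_pos)
  then have "smooth (\<lambda>x. B x / (B x + 1 / n))"
    unfolding B_def by (intro smooth_divide smooth_add smooth_bump smooth_const) (metis less_irrefl)
  moreover have "B x / (B x + 1 / n) = 0" if "x \<notin> {a + 1 / n..b - 1 / n}" for x
    using that bump_eq_0[of x "a + 1 / n" "b - 1 / n"] by (auto simp: B_def)
  moreover have "{a + 1 / n..b - 1 / n} \<subseteq> {p<..<q}"
  proof -
    have "1 / n > 0" using assms by simp
    then show ?thesis
      using assms(2,3) unfolding subset_iff atLeastAtMost_iff greaterThanLessThan_iff by (intro allI impI) linarith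
  qed
  ultimately show ?thesis unfolding test_functions_iff by blast
qed

lemma cutoff_tendsto:
  fixes x a b :: real
  defines "B \<equiv> \<lambda>n::nat. bump (a + 1 / Suc n) (b - 1 / Suc n)"
  shows "(\<lambda>n. B n x / (B n x + 1 / Suc n)) \<longlonglongrightarrow> indicator {a<..<b} x"
proof (cases "x \<in> {a<..<b}")
  case True
  have inv: "(\<lambda>n. 1 / real (Suc n)) \<longlonglongrightarrow> 0" by (rule LIMSEQ_Suc[OF lim_1_over_n])
  have "(\<lambda>n. flat_exp 0 (x - (a + 1 / Suc n))) \<longlonglongrightarrow> flat_exp 0 (x - (a + 0))"
    "(\<lambda>n. flat_exp 0 (b - 1 / Suc n - x)) \<longlonglongrightarrow> flat_exp 0 (b - 0 - x)"
    by (intro isCont_tendsto_compose[OF DERIV_isCont[OF flat_exp_has_deriv]] tendsto_intros inv)+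
  then have "(\<lambda>n. B n x) \<longlonglongrightarrow> bump a b x"
    unfolding B_def bump_def by (intro tendsto_mult) simp_all
  moreover have "bump a b x > 0" using True bump_pos by simp
  ultimately have "(\<lambda>n. B n x / (B n x + 1 / Suc n)) \<longlonglongrightarrow> bump a b x / (bump a b x + 0)"
    by (intro tendsto_intros inv) auto
  then show ?thesis using True \<open>bump a b x > 0\<close> by simp
next
  case False
  have "B n x = 0" for n
  proof -
    have "1 / real (Suc n) > 0" by simp
    then have "x \<le> a + 1 / Suc n \<or> b - 1 / Suc n \<le> x"
      using False unfolding greaterThanLessThan_iff by linarith
    then show ?thesis unfolding B_def by (rule bump_eq_0)
  qed
  then show ?thesis using False by simp
qed

lemma integral_lebesgue_Ioo:
  fixes f :: "real \<Rightarrow> real"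
  shows "(\<integral>x. indicator {p<..<q} x * f x \<partial>lebesgue) = (\<integral>x. f x \<partial>lebesgue_on {p<..<q})"
  by (simp add: integral_restrict_space)

text \<open>Cutoffs and dominated convergence with majorant |g| show that g has integral zero over
  every subinterval. This extends to Borel sets by a Dynkin argument and to Lebesgue sets by
  completion, and an integrable function with zero integral over every measurable set vanishes
  almost everywhere.\<close>

lemma fundamental_lemma:
  assumes g: "g \<in> L2_space {p<..<q}"
    and 0: "\<And>\<phi>. \<phi> \<in> test_functions {p<..<q} \<Longrightarrow> (\<integral>x. g x * \<phi> x \<partial>lebesgue_on {p<..<q}) = 0"
  shows "AE x in lebesgue_on {p<..<q}. g x = 0"
proof -
  let ?S = "{p<..<q}"
  define G where "G x = indicator ?S x * g x" for x
  have int_g: "integrable (lebesgue_on ?S) g" using g by (rule L2_space_integrable)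
  then have int_G: "integrable lebesgue G"
    using integrable_restrict_space[of ?S lebesgue g] by (simp add: G_def[abs_def])
  define P where "P A \<longleftrightarrow> (\<integral>x\<in>A. G x \<partial>lebesgue) = 0" for A
  have box: "P {a<..<b}" for a b
  proof -
    \<comment> \<open>Clipping makes the cutoffs admissible test functions and leaves the integral
      unchanged, because \<open>G\<close> is zero outside the interval.\<close>
    define a' b' where "a' = max a p" and "b' = min b q"
    define B where "B n = bump (a' + 1 / Suc n) (b' - 1 / Suc n)" for n :: nat
    define X where "X n x = B n x / (B n x + 1 / Suc n)" for n x
    have "(\<lambda>x. X n x) \<in> test_functions ?S" for n
      unfolding X_def B_def by (rule cutoff_test_function) (auto simp: a'_def b'_def)
    note test = this
    have le1: "\<bar>X n x\<bar> \<le> 1" for n x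
      using bump_nonneg[of "a' + 1 / Suc n" "b' - 1 / Suc n" x]
      by (auto simp: X_def B_def abs_le_iff divide_le_eq add_nonneg_pos le_divide_eq)
    have "(\<lambda>n. \<integral>x. g x * X n x \<partial>lebesgue_on ?S) \<longlonglongrightarrow> (\<integral>x. g x * indicator {a'<..<b'} x \<partial>lebesgue_on ?S)"
    proof (rule integral_dominated_convergence)
      show "integrable (lebesgue_on ?S) (\<lambda>x. \<bar>g x\<bar>)" using int_g by simp
      show "AE x in lebesgue_on ?S. (\<lambda>n. g x * X n x) \<longlonglongrightarrow> g x * indicator {a'<..<b'} x"
        unfolding X_def B_def by (intro always_eventually allI tendsto_mult tendsto_const cutoff_tendsto)
      show "AE x in lebesgue_on ?S. norm (g x * X n x) \<le> \<bar>g x\<bar>" for n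
        using le1 by (auto simp: abs_mult mult_left_le)
      have [measurable]: "g \<in> borel_measurable (lebesgue_on ?S)" using int_g by auto
      have "X n \<in> borel_measurable (lebesgue_on ?S)" for n
        using test[of n] smooth_continuous[of "X n" "{p..q}"]
        by (intro borel_measurable_integrable integrable_Ioo) (auto simp: test_functions_iff)
      then show "(\<lambda>x. g x * X n x) \<in> borel_measurable (lebesgue_on ?S)" for n by simp
      have "(\<lambda>x. indicator {a'<..<b'} x :: real) \<in> borel_measurable (lebesgue_on ?S)"
        by (intro measurable_restrict_space1 borel_measurable_indicator) simp
      then show "(\<lambda>x. g x * indicator {a'<..<b'} x) \<in> borel_measurable (lebesgue_on ?S)" by simp
    qed
    then have "(\<integral>x. g x * indicator {a'<..<b'} x \<partial>lebesgue_on ?S) = 0"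
      using 0[OF test] by (simp add: LIMSEQ_const_iff)
    moreover have "indicator {a<..<b} x * G x = indicator ?S x * (g x * indicator {a'<..<b'} x)" for x
      by (auto simp: G_def a'_def b'_def indicator_def)
    ultimately show ?thesis
      by (simp add: P_def set_lebesgue_integral_def integral_lebesgue_Ioo)
  qed
  \<comment> \<open>Open intervals are an intersection-stable generator of the Borel sets. The
    complement step needs the total integral of \<open>G\<close> to be zero, which is
    \<open>P\<close> for the whole interval {p<..<q}.\<close>
  have "P A" if "A \<in> sets borel" for A
  proof -
    let ?Gen = "range (\<lambda>(a, b). box a b :: real set)"
    have sets: "sets borel = sigma_sets UNIV ?Gen"
      by (metis borel_eq_box sets_measure_of subset_UNIV Pow_UNIV)
    have "Int_stable ?Gen"
      unfolding Int_stable_def by (auto simp: box_real intro!: image_eqI[of _ _ "(max _ _, min _ _)"])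
    moreover have "?Gen \<subseteq> Pow UNIV" by simp
    moreover have "A \<in> sigma_sets UNIV ?Gen" using that sets by simp
    ultimately show "P A"
    proof (induction rule: sigma_sets_induct_disjoint)
      case (basic A)
      then show ?case using box by (auto simp: box_real)
    next
      case empty
      then show ?case by (simp add: P_def set_lebesgue_integral_def)
    next
      case (compl A)
      then have [measurable]: "A \<in> sets borel" using sets by simp
      have "(\<integral>x. G x \<partial>lebesgue) = 0"
        using box[of p q] by (simp add: P_def set_lebesgue_integral_def G_def flip: mult.assoc indicator_inter_arith)
      moreover have "(\<integral>x\<in>UNIV - A. G x \<partial>lebesgue) = (\<integral>x. G x - indicator A x *\<^sub>R G x \<partial>lebesgue)"
        unfolding set_lebesgue_integral_def by (intro Bochner_Integration.integral_cong) (auto simp: indicator_def)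
      moreover have "\<dots> = (\<integral>x. G x \<partial>lebesgue) - (\<integral>x\<in>A. G x \<partial>lebesgue)"
        unfolding set_lebesgue_integral_def
        by (intro Bochner_Integration.integral_diff int_G integrable_mult_indicator) auto
      ultimately show ?case using compl by (simp add: P_def)
    next
      case (union A)
      have m: "A i \<in> sets lebesgue" for i using union sets by (auto simp: image_subset_iff)
      have "(\<integral>x\<in>(\<Union>i. A i). G x \<partial>lebesgue) = (\<Sum>i. \<integral>x\<in>A i. G x \<partial>lebesgue)"
      proof (rule lebesgue_integral_countable_add)
        show "A i \<inter> A j = {}" if "i \<noteq> j" for i j
          using union that by (auto simp: disjoint_family_on_def)
        show "set_integrable lebesgue (\<Union>i. A i) G"
          unfolding set_integrable_def by (intro integrable_mult_indicator int_G sets.countable_UN) (use m in auto)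
      qed (rule m)
      then show ?case using union by (simp add: P_def)
    qed
  qed
  \<comment> \<open>A Lebesgue set is a Borel set together with a part of a Borel null set, and the
    latter does not affect the integral.\<close>
  then have "(\<integral>x\<in>A. G x \<partial>lebesgue) = 0" if leb: "A \<in> sets lebesgue" for A
  proof -
    obtain B N N' where A: "A = B \<union> N" "N \<subseteq> N'" "N' \<in> null_sets lborel" "B \<in> sets lborel"
      using sets_completionE[OF leb] .
    have m: "B \<in> sets lebesgue" using A(4) by simp
    have "AE x in lebesgue. x \<notin> N'"
      using A(3) by (intro AE_not_in null_sets_completionI)
    then have "AE x in lebesgue. indicator A x *\<^sub>R G x = indicator B x *\<^sub>R G x"
      by eventually_elim (use A(1,2) in \<open>auto simp: indicator_def\<close>)
    then have "(\<integral>x\<in>A. G x \<partial>lebesgue) = (\<integral>x\<in>B. G x \<partial>lebesgue)"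
      unfolding set_lebesgue_integral_def
      by (intro integral_cong_AE borel_measurable_integrable integrable_mult_indicator int_G that m)
    then show ?thesis using \<open>\<And>A. A \<in> sets borel \<Longrightarrow> P A\<close>[of B] A(4) by (simp add: P_def)
  qed
  then have "AE x in lebesgue. G x = 0"
    using int_G by (intro density_unique_real) (auto simp: set_lebesgue_integral_def)
  then show ?thesis
    by (subst AE_restrict_space_iff) (auto simp: G_def indicator_def elim: eventually_mono)
qed

subsection \<open>Weak derivatives on an interval\<close>

text \<open>Since \<open>weak_deriv\<close> is an arbitrary choice, this is what permits replacing
  it by a known derivative under an integral.\<close>

lemma has_weak_deriv_unique:
  assumes "g \<in> L2_space {p<..<q}" "h \<in> L2_space {p<..<q}"
    and "has_weak_deriv {p<..<q} u g" "has_weak_deriv {p<..<q} u h"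
  shows "AE x in lebesgue_on {p<..<q}. g x = h x"
proof -
  let ?M = "lebesgue_on {p<..<q}"
  have "(\<integral>x. (g x - h x) * \<phi> x \<partial>?M) = 0" if \<phi>: "\<phi> \<in> test_functions {p<..<q}" for \<phi>
  proof -
    have "\<phi> \<in> L2_space {p<..<q}"
      using \<phi> by (auto simp: test_functions_iff intro: L2_space_continuous smooth_continuous)
    then have "(\<integral>x. g x * \<phi> x - h x * \<phi> x \<partial>?M) = (\<integral>x. g x * \<phi> x \<partial>?M) - (\<integral>x. h x * \<phi> x \<partial>?M)"
      using assms by (intro Bochner_Integration.integral_diff L2_space_mult_integrable)
    moreover have "(\<integral>x. g x * \<phi> x \<partial>?M) = (\<integral>x. h x * \<phi> x \<partial>?M)"
      using assms(3,4)[unfolded has_weak_deriv_def, rule_format, OF \<phi>] by linarith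
    ultimately show ?thesis by (simp add: left_diff_distrib)
  qed
  then have "AE x in ?M. g x - h x = 0"
    by (intro fundamental_lemma L2_space_diff assms)
  then show ?thesis by simp
qed

lemma weak_deriv_works:
  assumes "u \<in> H1_space S"
  shows "weak_deriv S u \<in> L2_space S" "has_weak_deriv S u (weak_deriv S u)"
proof -
  have "\<exists>g. g \<in> L2_space S \<and> has_weak_deriv S u g"
    using assms by (auto simp: H1_space_def)
  then have "weak_deriv S u \<in> L2_space S \<and> has_weak_deriv S u (weak_deriv S u)"
    unfolding weak_deriv_def by (rule someI_ex)
  then show "weak_deriv S u \<in> L2_space S" "has_weak_deriv S u (weak_deriv S u)" by auto
qed

lemma test_function_vanishes:
  assumes "\<phi> \<in> test_functions {p<..<q}" "x \<notin> {p<..<q}"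
  shows "\<phi> x = 0"
  using assms unfolding test_functions_iff by (metis subsetD)

lemma integral_test_by_parts:
  assumes "p < q" and \<phi>: "\<phi> \<in> test_functions {p<..<q}"
    and f: "\<And>x. x \<in> {p..q} \<Longrightarrow> (f has_real_derivative f' x) (at x within {p..q})"
    and cont: "continuous_on {p..q} f'"
  shows "(\<integral>x. f x * deriv \<phi> x \<partial>lebesgue_on {p<..<q}) = - (\<integral>x. f' x * \<phi> x \<partial>lebesgue_on {p<..<q})"
proof -
  have sm: "smooth \<phi>" using \<phi> by (simp add: test_functions_iff)
  have c: "continuous_on {p..q} f" using f by (blast intro: DERIV_continuous_on)
  have "integral {p..q} (\<lambda>x. f x * deriv \<phi> x) = - integral {p..q} (\<lambda>x. f' x * \<phi> x)"
    using assms(1) sm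
    by (intro integral_by_parts_vanishing)
       (auto intro: f cont smooth_has_deriv smooth_continuous smooth_deriv has_field_derivative_at_within
          simp: test_function_vanishes[OF \<phi>])
  then show ?thesis
    by (simp add: integral_Ioo continuous_on_mult[OF c smooth_continuous[OF smooth_deriv[OF sm]]]
        continuous_on_mult[OF cont smooth_continuous[OF sm]])
qed

text \<open>The constant sequence \<open>\<phi>\<close> approximates itself, once the chosen weak
  derivative is identified almost everywhere with the classical one. This makes test functions
  admissible in the weak equation.\<close>

lemma test_function_H10:
  assumes "p < q" and \<phi>: "\<phi> \<in> test_functions {p<..<q}"
  shows "\<phi> \<in> H10_space {p<..<q}"
    and "AE x in lebesgue_on {p<..<q}. weak_deriv {p<..<q} \<phi> x = deriv \<phi> x"
proof -
  let ?S = "{p<..<q}"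
  have sm: "smooth \<phi>" using \<phi> by (simp add: test_functions_iff)
  have L2: "\<phi> \<in> L2_space ?S" "deriv \<phi> \<in> L2_space ?S"
    by (intro L2_space_continuous smooth_continuous smooth_deriv sm)+
  have "has_weak_deriv ?S \<phi> (deriv \<phi>)"
    unfolding has_weak_deriv_def
  proof
    fix \<theta> assume "\<theta> \<in> test_functions ?S"
    then show "(\<integral>x. \<phi> x * deriv \<theta> x \<partial>lebesgue_on ?S) = - (\<integral>x. deriv \<phi> x * \<theta> x \<partial>lebesgue_on ?S)"
      using assms(1)
      by (intro integral_test_by_parts)
         (auto intro: smooth_has_deriv smooth_continuous smooth_deriv sm has_field_derivative_at_within)
  qed
  note wd = this
  have H1: "\<phi> \<in> H1_space ?S" using L2 wd by (auto simp: H1_space_def)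
  show ae: "AE x in lebesgue_on ?S. weak_deriv ?S \<phi> x = deriv \<phi> x"
    using weak_deriv_works[OF H1] L2(2) wd by (intro has_weak_deriv_unique)
  have "(\<integral>x. (deriv \<phi> x - weak_deriv ?S \<phi> x)\<^sup>2 \<partial>lebesgue_on ?S) = 0"
    by (rule integral_eq_zero_AE) (use ae in \<open>auto elim: eventually_mono\<close>)
  then show "\<phi> \<in> H10_space ?S"
    using H1 \<phi> by (auto simp: H10_space_def intro!: exI[of _ "\<lambda>n. \<phi>"])
qed

section \<open>Continuous representatives of H^1_0 functions\<close>

lemma measure_lebesgue_on_Ioo: "p \<le> q \<Longrightarrow> measure (lebesgue_on {p<..<q}) {p<..<q} = q - p"
  for p q :: real
  using integral_Ioo[of p q "\<lambda>x. 1"] by simp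

text \<open>Cauchy-Schwarz against the constant 1, obtained by expanding \<integral> (|k| - m)^2
  \<ge> 0 with \<open>m\<close> the mean value of |k|.\<close>

lemma integral_abs_le_L2:
  assumes "p < q" and k: "k \<in> L2_space {p<..<q}"
  shows "(\<integral>x. \<bar>k x\<bar> \<partial>lebesgue_on {p<..<q}) \<le> sqrt ((q - p) * (\<integral>x. (k x)\<^sup>2 \<partial>lebesgue_on {p<..<q}))"
proof -
  let ?M = "lebesgue_on {p<..<q}"
  define I J where "I = (\<integral>x. \<bar>k x\<bar> \<partial>?M)" and "J = (\<integral>x. (k x)\<^sup>2 \<partial>?M)"
  define m where "m = I / (q - p)"
  have int: "integrable ?M (\<lambda>x. \<bar>k x\<bar>)" "integrable ?M (\<lambda>x. (k x)\<^sup>2)"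
    using L2_space_integrable[OF k] k by (auto simp: L2_space_def)
  have int_c: "integrable ?M (\<lambda>x. m\<^sup>2)" by (rule integrable_Ioo) simp
  have c: "(\<integral>x. m\<^sup>2 \<partial>?M) = m\<^sup>2 * (q - p)"
    using assms(1) by (simp add: measure_lebesgue_on_Ioo)
  have "0 \<le> (\<integral>x. (\<bar>k x\<bar> - m)\<^sup>2 \<partial>?M)" by (rule integral_nonneg_AE) simp
  also have "\<dots> = (\<integral>x. (k x)\<^sup>2 - 2 * m * \<bar>k x\<bar> + m\<^sup>2 \<partial>?M)"
    by (simp add: power2_diff algebra_simps)
  also have "\<dots> = J - 2 * m * I + m\<^sup>2 * (q - p)"
    using int int_c c by (simp add: I_def J_def del: lebesgue_integral_const)
  also have "\<dots> = J - m * I"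
  proof -
    have "m\<^sup>2 * (q - p) = m * I" using assms(1) by (simp add: m_def power2_eq_square)
    then show ?thesis by simp
  qed
  also have "\<dots> = J - I\<^sup>2 / (q - p)"
    by (simp add: m_def power2_eq_square)
  finally have "I\<^sup>2 \<le> (q - p) * J"
    using assms(1) by (simp add: field_simps)
  then show ?thesis unfolding I_def J_def by (rule real_le_rsqrt)
qed

lemma L2_space_indicator_atMost:
  assumes "h \<in> L2_space {p<..<q}"
  shows "integrable (lebesgue_on {p<..<q}) (\<lambda>t. indicator {..x} t * h t)"
proof -
  let ?S = "{p<..<q}"
  have "{..x} \<inter> ?S \<in> sets (lebesgue_on ?S)" by (auto simp: sets_restrict_space)
  then have "integrable (lebesgue_on ?S) (\<lambda>t. indicator ({..x} \<inter> ?S) t *\<^sub>R h t)"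
    using L2_space_integrable[OF assms] by (rule integrable_mult_indicator)
  moreover have "integrable (lebesgue_on ?S) (\<lambda>t. indicator ({..x} \<inter> ?S) t *\<^sub>R h t)
    \<longleftrightarrow> integrable (lebesgue_on ?S) (\<lambda>t. indicator {..x} t * h t)"
    by (rule Bochner_Integration.integrable_cong) (auto simp: indicator_def)
  ultimately show ?thesis by simp
qed

lemma integral_indicator_atMost:
  fixes h :: "real \<Rightarrow> real"
  assumes "continuous_on {p..q} h" "x \<in> {p..q}"
  shows "(\<integral>t. indicator {..x} t * h t \<partial>lebesgue_on {p<..<q}) = integral {p..x} h"
proof -
  have "(\<integral>t. indicator {..x} t * h t \<partial>lebesgue_on {p<..<q}) = integral {p<..<q} (\<lambda>t. indicator {..x} t * h t)"
    using L2_space_indicator_atMost[OF L2_space_continuous[OF assms(1)]]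
    by (intro lebesgue_integral_eq_integral) auto
  also have "\<dots> = integral {p..q} (\<lambda>t. if t \<in> {..x} then h t else 0)"
    by (subst integral_open_interval_real) (rule integral_cong, auto simp: indicator_def)
  also have "\<dots> = integral ({..x} \<inter> {p..q}) h"
    by (rule Henstock_Kurzweil_Integration.integral_restrict_Int)
  also have "{..x} \<inter> {p..q} = {p..x}" using assms(2) by auto
  finally show ?thesis .
qed

text \<open>The one-dimensional Sobolev embedding together with zero boundary values. The
  representative is the integral of the weak derivative from the left end. Approximating test
  functions are integrals of their own derivatives, so \<open>integral_abs_le_L2\<close> bounds
  their distance to \<open>U\<close> uniformly by the L^2 distance of the derivatives. The uniform
  limit inherits continuity and the zeros at both ends.\<close>

lemma H10_continuous_representative:
  assumes "p < q" and u: "u \<in> H10_space {p<..<q}"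
  obtains U where "continuous_on {p..q} U" "U p = 0" "U q = 0"
    "AE x in lebesgue_on {p<..<q}. u x = U x"
    "\<And>x. x \<in> {p..q} \<Longrightarrow>
      U x = (\<integral>t. indicator {..x} t * weak_deriv {p<..<q} u t \<partial>lebesgue_on {p<..<q})"
proof -
  let ?S = "{p<..<q}"
  let ?M = "lebesgue_on ?S"
  define g where "g = weak_deriv ?S u"
  have uL2: "u \<in> L2_space ?S" and uH1: "u \<in> H1_space ?S"
    using u by (auto simp: H10_space_def H1_space_def)
  have g: "g \<in> L2_space ?S" unfolding g_def by (rule weak_deriv_works[OF uH1])
  obtain \<phi> where \<phi>: "\<And>n. \<phi> n \<in> test_functions ?S" and
    lim: "(\<lambda>n. (\<integral>x. (\<phi> n x - u x)\<^sup>2 \<partial>?M) + (\<integral>x. (deriv (\<phi> n) x - g x)\<^sup>2 \<partial>?M)) \<longlonglongrightarrow> 0"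
    using u by (auto simp: H10_space_def g_def)
  define e0 e1 where "e0 n = (\<integral>x. (\<phi> n x - u x)\<^sup>2 \<partial>?M)"
    and "e1 n = (\<integral>x. (deriv (\<phi> n) x - g x)\<^sup>2 \<partial>?M)" for n
  have nonneg: "e0 n \<ge> 0" "e1 n \<ge> 0" for n by (simp_all add: e0_def e1_def)
  have e: "e0 \<longlonglongrightarrow> 0" "e1 \<longlonglongrightarrow> 0"
    by (rule tendsto_sandwich[OF _ _ tendsto_const lim]; use nonneg in \<open>simp flip: e0_def e1_def\<close>)+
  have sm: "smooth (\<phi> n)" for n using \<phi> by (simp add: test_functions_iff)
  have L2: "\<phi> n \<in> L2_space ?S" "deriv (\<phi> n) \<in> L2_space ?S" for n
    by (intro L2_space_continuous smooth_continuous smooth_deriv sm)+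
  define U where "U x = (\<integral>t. indicator {..x} t * g t \<partial>?M)" for x
  have \<phi>_eq: "\<phi> n x = (\<integral>t. indicator {..x} t * deriv (\<phi> n) t \<partial>?M)" if x: "x \<in> {p..q}" for n x
  proof -
    have "(\<integral>t. indicator {..x} t * deriv (\<phi> n) t \<partial>?M) = integral {p..x} (deriv (\<phi> n))"
      by (intro integral_indicator_atMost smooth_continuous smooth_deriv sm x)
    also have "\<dots> = \<phi> n x - \<phi> n p"
      using x smooth_has_deriv[OF sm]
      by (intro integral_unique fundamental_theorem_of_calculus)
         (auto simp flip: has_real_derivative_iff_has_vector_derivative intro: has_field_derivative_at_within)
    also have "\<phi> n p = 0" using \<phi> by (intro test_function_vanishes) auto
    finally show ?thesis by simp
  qed
  have bound: "\<bar>\<phi> n x - U x\<bar> \<le> sqrt ((q - p) * e1 n)" if x: "x \<in> {p..q}" for n x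
  proof -
    have d: "(\<lambda>t. deriv (\<phi> n) t - g t) \<in> L2_space ?S" by (intro L2_space_diff L2 g)
    have "\<phi> n x - U x = (\<integral>t. indicator {..x} t * (deriv (\<phi> n) t - g t) \<partial>?M)"
      unfolding \<phi>_eq[OF x] U_def right_diff_distrib
      by (intro Bochner_Integration.integral_diff[symmetric] L2_space_indicator_atMost L2 g)
    also have "\<bar>\<dots>\<bar> \<le> (\<integral>t. \<bar>indicator {..x} t * (deriv (\<phi> n) t - g t)\<bar> \<partial>?M)"
      by (rule integral_abs_bound)
    also have "\<dots> \<le> (\<integral>t. \<bar>deriv (\<phi> n) t - g t\<bar> \<partial>?M)"
      using L2_space_integrable[OF d] L2_space_indicator_atMost[OF d]
      by (intro integral_mono integrable_abs) (auto simp: indicator_def)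
    also have "\<dots> \<le> sqrt ((q - p) * e1 n)"
      unfolding e1_def by (rule integral_abs_le_L2[OF assms(1) d])
    finally show ?thesis .
  qed
  have s0: "(\<lambda>n. sqrt ((q - p) * e1 n)) \<longlonglongrightarrow> 0"
    using tendsto_real_sqrt[OF tendsto_mult[OF tendsto_const[of "q - p"] e(2)]] by simp
  have unif: "uniform_limit {p..q} \<phi> U sequentially"
  proof (rule uniform_limitI)
    fix d :: real assume "d > 0"
    have "\<forall>\<^sub>F n in sequentially. sqrt ((q - p) * e1 n) < d"
      using order_tendstoD(2)[OF s0 \<open>d > 0\<close>] .
    then show "\<forall>\<^sub>F n in sequentially. \<forall>x\<in>{p..q}. dist (\<phi> n x) (U x) < d"
      by eventually_elim (auto simp: dist_real_def intro: le_less_trans[OF bound])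
  qed
  have contU: "continuous_on {p..q} U"
    by (rule uniform_limit_theorem[OF _ unif]) (auto intro!: always_eventually smooth_continuous sm)
  have pw: "(\<lambda>n. \<phi> n x) \<longlonglongrightarrow> U x" if "x \<in> {p..q}" for x
    using tendsto_uniform_limitI[OF unif that] .
  have "U p = 0" "U q = 0"
    using pw[of p] pw[of q] test_function_vanishes[OF \<phi>] assms(1) by (auto simp: LIMSEQ_const_iff)
  moreover have "AE x in ?M. u x = U x"
  proof -
    have UL2: "U \<in> L2_space ?S" by (rule L2_space_continuous[OF contU])
    define c where "c = (\<integral>x. (U x - u x)\<^sup>2 \<partial>?M)"
    have int: "integrable ?M (\<lambda>x. (f x - h x)\<^sup>2)" if "f \<in> L2_space ?S" "h \<in> L2_space ?S" for f h
      using L2_space_diff[OF that] by (simp add: L2_space_def)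
    \<comment> \<open>From (U - u)^2 \<le> 2 (\<phi> - U)^2 + 2 (\<phi> - u)^2: the first term is
      bounded pointwise by the uniform estimate, which brings a second factor q - p upon
      integration; the second term integrates to \<open>2 * e0 n\<close>.\<close>
    have "c \<le> 2 * ((q - p) * ((q - p) * e1 n)) + 2 * e0 n" for n
    proof -
      have "c \<le> (\<integral>x. 2 * ((q - p) * e1 n) + 2 * (\<phi> n x - u x)\<^sup>2 \<partial>?M)"
        unfolding c_def
      proof (rule integral_mono)
        show "integrable ?M (\<lambda>x. (U x - u x)\<^sup>2)" by (rule int[OF UL2 uL2])
        show "integrable ?M (\<lambda>x. 2 * ((q - p) * e1 n) + 2 * (\<phi> n x - u x)\<^sup>2)"
          by (intro Bochner_Integration.integrable_add integrable_Ioo[OF continuous_on_const]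
              integrable_mult_right[OF int] L2 uL2)
        fix x assume "x \<in> space ?M"
        then have "\<bar>\<phi> n x - U x\<bar> \<le> sqrt ((q - p) * e1 n)" by (intro bound) auto
        then have "(\<phi> n x - U x)\<^sup>2 \<le> (q - p) * e1 n"
          using assms(1) nonneg[of n] by (simp add: sqrt_ge_absD)
        moreover have "(U x - u x)\<^sup>2 \<le> 2 * (\<phi> n x - U x)\<^sup>2 + 2 * (\<phi> n x - u x)\<^sup>2"
          using zero_le_power2[of "(\<phi> n x - U x) + (\<phi> n x - u x)"]
          by (simp add: power2_eq_square algebra_simps)
        ultimately show "(U x - u x)\<^sup>2 \<le> 2 * ((q - p) * e1 n) + 2 * (\<phi> n x - u x)\<^sup>2" by linarith
      qed
      also have "\<dots> = (\<integral>x. 2 * ((q - p) * e1 n) \<partial>?M) + (\<integral>x. 2 * (\<phi> n x - u x)\<^sup>2 \<partial>?M)"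
        by (intro Bochner_Integration.integral_add integrable_Ioo[OF continuous_on_const]
            integrable_mult_right[OF int] L2 uL2)
      also have "\<dots> = 2 * ((q - p) * ((q - p) * e1 n)) + 2 * e0 n"
        using assms(1) by (simp add: e0_def measure_lebesgue_on_Ioo)
      finally show ?thesis .
    qed
    moreover have "(\<lambda>n. 2 * ((q - p) * ((q - p) * e1 n)) + 2 * e0 n) \<longlonglongrightarrow> 2 * ((q - p) * ((q - p) * 0)) + 2 * 0"
      by (intro tendsto_intros e)
    ultimately have "c \<le> 0" by (intro LIMSEQ_le_const[where a = c]) auto
    moreover have "c \<ge> 0" by (simp add: c_def)
    ultimately have "c = 0" by (rule antisym)
    then have "AE x in ?M. (U x - u x)\<^sup>2 = 0"
      using integral_nonneg_eq_0_iff_AE[OF int[OF UL2 uL2]] by (simp add: c_def)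
    then show ?thesis by (auto elim: eventually_mono)
  qed
  ultimately show ?thesis using that[OF contU] by (simp add: U_def g_def)
qed

section \<open>The du Bois-Reymond lemma\<close>

lemma test_function_antiderivative:
  assumes "p < q" and k: "k \<in> test_functions {p<..<q}"
    and 0: "(\<integral>x. k x \<partial>lebesgue_on {p<..<q}) = 0"
  obtains \<phi> where "\<phi> \<in> test_functions {p<..<q}" "deriv \<phi> = k"
proof -
  obtain c d where sm: "smooth k" and cd: "p < c" "d < q" "c \<le> d" "\<And>x. x \<notin> {c..d} \<Longrightarrow> k x = 0"
    using k unfolding test_functions_Ioo[OF assms(1)] by blast
  \<comment> \<open>The primitive is taken on the whole line because \<open>smooth\<close> speaks of
    all real arguments.\<close>
  have "\<exists>F. \<forall>x::real. - \<infinity> < ereal x \<longrightarrow> ereal x < \<infinity> \<longrightarrow> (F has_vector_derivative k x) (at x)"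
    using DERIV_isCont[OF smooth_has_deriv[OF sm]] by (intro einterval_antiderivative) auto
  then obtain F where F: "\<And>x. (F has_real_derivative k x) (at x)"
    by (auto simp: has_real_derivative_iff_has_vector_derivative)
  define \<phi> where "\<phi> x = F x - F p" for x
  have D: "(\<phi> has_real_derivative k x) (at x)" for x
    unfolding \<phi>_def by (auto intro!: derivative_eq_intros F)
  have "integral {p..q} k = \<phi> q - \<phi> p"
    using assms(1) D by (intro integral_unique fundamental_theorem_of_calculus)
      (auto simp flip: has_real_derivative_iff_has_vector_derivative intro: has_field_derivative_at_within)
  moreover have "integral {p..q} k = 0"
    using 0 by (simp add: integral_Ioo smooth_continuous[OF sm])
  ultimately have ends: "\<phi> p = 0" "\<phi> q = 0" by (simp_all add: \<phi>_def)
  \<comment> \<open>A primitive is constant on either side of the support of \<open>k\<close>.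
    Normalisation at \<open>p\<close> makes the left constant zero, and the zero mean of
    \<open>k\<close> makes the right one zero, so the primitive has compact support.\<close>
  have const: "\<phi> x = \<phi> y" if "x \<le> y" "\<And>z. x < z \<Longrightarrow> z < y \<Longrightarrow> k z = 0" for x y
  proof (cases "x < y")
    case True
    obtain z where "x < z" "z < y" "\<phi> y - \<phi> x = (y - x) * k z"
      using MVT2[OF True, of \<phi> k] D by blast
    then show ?thesis using that(2) by simp
  qed (use that in simp)
  have "\<phi> x = 0" if "x \<notin> {c..d}" for x
  proof (cases "x < c")
    case True
    then have "k z = 0" if "z < max x p" for z using that cd(1) by (intro cd(4)) auto
    then have "\<phi> x = \<phi> p"
      using const[of x p] const[of p x, THEN sym] by (meson less_max_iff_disj linear)
    then show ?thesis using ends by simp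
  next
    case False
    then have "x > d" using that by simp
    then have "k z = 0" if "min x q < z" for z using that cd(2) by (intro cd(4)) auto
    then have "\<phi> x = \<phi> q"
      using const[of x q] const[of q x, THEN sym] by (meson min_less_iff_disj linear)
    then show ?thesis using ends by simp
  qed
  then have "\<phi> \<in> test_functions {p<..<q}"
    unfolding test_functions_Ioo[OF assms(1)] using smooth_antideriv[OF D sm] cd(1-3) by blast
  moreover have "deriv \<phi> = k" using D by (auto intro: DERIV_imp_deriv)
  ultimately show ?thesis by (rule that)
qed

lemma test_functions_diff:
  assumes "\<phi> \<in> test_functions S" "\<psi> \<in> test_functions S"
  shows "(\<lambda>x. \<phi> x - r * \<psi> x) \<in> test_functions S"
proof -
  obtain K L where "smooth \<phi>" "compact K" "K \<subseteq> S" "\<And>x. x \<notin> K \<Longrightarrow> \<phi> x = 0"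
    "smooth \<psi>" "compact L" "L \<subseteq> S" "\<And>x. x \<notin> L \<Longrightarrow> \<psi> x = 0"
    using assms unfolding test_functions_iff by blast
  then show ?thesis
    unfolding test_functions_iff
    by (intro conjI exI[of _ "K \<union> L"]) (auto intro!: smooth_diff smooth_mult[OF smooth_const])
qed

text \<open>Only test functions of mean zero are derivatives of test functions. Correcting an
  arbitrary \<theta> by a multiple of a fixed bump \<open>\<rho>\<close> with nonzero mass reaches
  mean zero, and the correction reappears as the constant C = \<integral> h \<rho> / \<integral>
  \<rho>, so h - C is orthogonal to every test function.\<close>

lemma du_Bois_Reymond:
  assumes "p < q" and h: "h \<in> L2_space {p<..<q}"
    and 0: "\<And>\<phi>. \<phi> \<in> test_functions {p<..<q} \<Longrightarrow> (\<integral>x. h x * deriv \<phi> x \<partial>lebesgue_on {p<..<q}) = 0"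
  obtains c where "AE x in lebesgue_on {p<..<q}. h x = c"
proof -
  let ?S = "{p<..<q}"
  let ?M = "lebesgue_on ?S"
  define c d where "c = (2 * p + q) / 3" and "d = (p + 2 * q) / 3"
  have cd: "p < c" "c < d" "d < q" using assms(1) by (auto simp: c_def d_def)
  define \<rho> where "\<rho> = bump c d"
  have sm: "smooth \<rho>" by (simp add: \<rho>_def smooth_bump)
  have \<rho>: "\<rho> \<in> test_functions ?S"
    unfolding test_functions_Ioo[OF assms(1)]
    using cd sm by (intro conjI exI[of _ c] exI[of _ d]) (auto simp: \<rho>_def bump_eq_0)
  define m where "m = (\<integral>x. \<rho> x \<partial>?M)"
  have "m \<noteq> 0"
  proof
    assume "m = 0"
    then have "integral {p..q} \<rho> = 0"
      by (simp add: m_def integral_Ioo smooth_continuous[OF sm])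
    then have "\<forall>x\<in>{p..q}. \<rho> x = 0"
      using integral_eq_0_iff[OF smooth_continuous[OF sm] assms(1)] bump_nonneg by (simp add: \<rho>_def)
    moreover have "\<rho> ((c + d) / 2) > 0" unfolding \<rho>_def using cd by (intro bump_pos) auto
    ultimately show False using cd by (auto simp: field_simps)
  qed
  have tL2: "\<theta> \<in> L2_space ?S" if "\<theta> \<in> test_functions ?S" for \<theta>
    using that by (auto simp: test_functions_iff intro: L2_space_continuous smooth_continuous)
  define C where "C = (\<integral>x. h x * \<rho> x \<partial>?M) / m"
  have "(\<integral>x. (h x - C) * \<theta> x \<partial>?M) = 0" if \<theta>: "\<theta> \<in> test_functions ?S" for \<theta>
  proof -
    define r where "r = (\<integral>x. \<theta> x \<partial>?M) / m"
    have "(\<integral>x. \<theta> x - r * \<rho> x \<partial>?M) = 0"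
      using L2_space_integrable[OF tL2[OF \<theta>]] L2_space_integrable[OF tL2[OF \<rho>]] \<open>m \<noteq> 0\<close>
      by (simp add: r_def flip: m_def)
    from test_function_antiderivative[OF assms(1) test_functions_diff[OF \<theta> \<rho>] this]
    obtain \<phi> where "\<phi> \<in> test_functions ?S" "deriv \<phi> = (\<lambda>x. \<theta> x - r * \<rho> x)" .
    then have "(\<integral>x. h x * (\<theta> x - r * \<rho> x) \<partial>?M) = 0" using 0[of \<phi>] by simp
    moreover have "(\<integral>x. h x * (\<theta> x - r * \<rho> x) \<partial>?M) = (\<integral>x. h x * \<theta> x - r * (h x * \<rho> x) \<partial>?M)"
      by (simp add: algebra_simps)
    moreover have "\<dots> = (\<integral>x. h x * \<theta> x \<partial>?M) - r * (\<integral>x. h x * \<rho> x \<partial>?M)"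
      using L2_space_mult_integrable[OF h tL2[OF \<theta>]] L2_space_mult_integrable[OF h tL2[OF \<rho>]] by simp
    moreover have "(\<integral>x. (h x - C) * \<theta> x \<partial>?M) = (\<integral>x. h x * \<theta> x - C * \<theta> x \<partial>?M)"
      by (simp add: algebra_simps)
    moreover have "\<dots> = (\<integral>x. h x * \<theta> x \<partial>?M) - C * (\<integral>x. \<theta> x \<partial>?M)"
      using L2_space_mult_integrable[OF h tL2[OF \<theta>]] L2_space_integrable[OF tL2[OF \<theta>]] by simp
    ultimately show ?thesis by (simp add: C_def r_def)
  qed
  then have "AE x in ?M. h x - C = 0"
    by (intro fundamental_lemma L2_space_diff h L2_space_continuous) auto
  then show ?thesis using that[of C] by simp
qed

subsection \<open>Regularity of weak solutions\<close>

text \<open>This is -U'' = f U with zero boundary values. The cubic term is absorbed into the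
  coefficient \<open>f\<close>, which may depend on \<open>U\<close>, so that linear arguments
  apply. Derivatives within the closed interval are one-sided at the ends and give regularity up to
  the boundary.\<close>

definition dirichlet_solution :: "real \<Rightarrow> real \<Rightarrow> (real \<Rightarrow> real) \<Rightarrow> (real \<Rightarrow> real) \<Rightarrow> (real \<Rightarrow> real) \<Rightarrow> bool" where
  "dirichlet_solution p q f U U' \<longleftrightarrow> U p = 0 \<and> U q = 0 \<and>
    (\<forall>x\<in>{p..q}. (U has_real_derivative U' x) (at x within {p..q})) \<and>
    (\<forall>x\<in>{p..q}. (U' has_real_derivative - (f x * U x)) (at x within {p..q}))"

lemma dirichlet_solution_continuous:
  assumes "dirichlet_solution p q f U U'"
  shows "continuous_on {p..q} U" "continuous_on {p..q} U'"
  using assms DERIV_continuous_on[of "{p..q}" U U'] DERIV_continuous_on[of "{p..q}" U' "\<lambda>x. - (f x * U x)"]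
  by (auto simp: dirichlet_solution_def)

text \<open>With F a primitive of l U - b U^3 and A = a(m), integrating the lower-order term by
  parts turns the weak equation into \<integral> (A g + F) \<phi>' = 0 for the weak derivative g.
  Hence A g + F is a constant c almost everywhere, and A > 0 allows solving for g, which thereby
  agrees almost everywhere with the C^1 function \<open>W\<close>.\<close>

lemma weak_solution_regular:
  assumes "p < q" and sol: "weak_solution {p<..<q} a l b u"
    and A: "a (deriv_norm_sq {p<..<q} u) > 0"
  obtains U U' where
    "dirichlet_solution p q (\<lambda>x. (l - b * (U x)\<^sup>2) / a (deriv_norm_sq {p<..<q} u)) U U'"
    "AE x in lebesgue_on {p<..<q}. u x = U x"
    "deriv_norm_sq {p<..<q} u = integral {p..q} (\<lambda>x. (U' x)\<^sup>2)"
proof -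
  let ?S = "{p<..<q}"
  let ?M = "lebesgue_on ?S"
  define A where "A = a (deriv_norm_sq ?S u)"
  define g where "g = weak_deriv ?S u"
  have A_pos: "A > 0" using A by (simp add: A_def)
  have H10: "u \<in> H10_space ?S" and uL2: "u \<in> L2_space ?S" and gL2: "g \<in> L2_space ?S"
    using sol weak_deriv_works by (auto simp: weak_solution_def H10_space_def H1_space_def g_def)
  obtain U where U: "continuous_on {p..q} U" "U p = 0" "U q = 0" "AE x in ?M. u x = U x"
    "\<And>x. x \<in> {p..q} \<Longrightarrow> U x = (\<integral>t. indicator {..x} t * g t \<partial>?M)"
    using H10_continuous_representative[OF assms(1) H10] unfolding g_def by blast
  define f where "f x = l * U x - b * U x ^ 3" for x
  define F where "F x = integral {p..x} f" for x
  have cf: "continuous_on {p..q} f" unfolding f_def by (intro continuous_intros U(1))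
  have F: "(F has_real_derivative f x) (at x within {p..q})" if "x \<in> {p..q}" for x
    unfolding F_def by (rule integral_has_real_derivative[OF cf that])
  have cF: "continuous_on {p..q} F" using F by (blast intro: DERIV_continuous_on)
  have hL2: "(\<lambda>x. A * g x + F x) \<in> L2_space ?S"
    by (intro L2_space_add L2_space_cmult gL2 L2_space_continuous cF)
  have [measurable]: "u \<in> borel_measurable ?M" "g \<in> borel_measurable ?M"
    using uL2 gL2 by (auto simp: L2_space_def)
  have meas: "k \<in> borel_measurable ?M" if "continuous_on {p..q} k" for k :: "real \<Rightarrow> real"
    using integrable_Ioo[OF that] by (rule borel_measurable_integrable)
  have "(\<integral>x. (A * g x + F x) * deriv \<phi> x \<partial>?M) = 0" if \<phi>: "\<phi> \<in> test_functions ?S" for \<phi>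
  proof -
    have sm: "smooth \<phi>" using \<phi> by (simp add: test_functions_iff)
    have c: "continuous_on {p..q} \<phi>" "continuous_on {p..q} (deriv \<phi>)"
      by (intro smooth_continuous smooth_deriv sm)+
    have "\<phi> \<in> H10_space ?S" and wd: "AE x in ?M. weak_deriv ?S \<phi> x = deriv \<phi> x"
      using test_function_H10[OF assms(1) \<phi>] by auto
    then have "weak_deriv ?S \<phi> \<in> L2_space ?S"
      by (intro weak_deriv_works) (auto simp: H10_space_def)
    then have [measurable]: "weak_deriv ?S \<phi> \<in> borel_measurable ?M" by (auto simp: L2_space_def)
    note [measurable] = meas[OF U(1)] meas[OF c(1)] meas[OF c(2)] meas[OF cf]
    have "A * (\<integral>x. g x * weak_deriv ?S \<phi> x \<partial>?M) + (\<integral>x. (- l * u x + b * u x ^ 3) * \<phi> x \<partial>?M) = 0"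
      using sol \<open>\<phi> \<in> H10_space ?S\<close> unfolding weak_solution_def A_def g_def by blast
    moreover have "(\<integral>x. g x * weak_deriv ?S \<phi> x \<partial>?M) = (\<integral>x. g x * deriv \<phi> x \<partial>?M)"
      by (rule integral_cong_AE) (use wd in \<open>auto elim: eventually_mono\<close>)
    moreover have "(\<integral>x. (- l * u x + b * u x ^ 3) * \<phi> x \<partial>?M) = (\<integral>x. - (f x * \<phi> x) \<partial>?M)"
      by (rule integral_cong_AE) (use U(4) in \<open>auto elim!: eventually_mono simp: f_def algebra_simps\<close>)
    moreover have "(\<integral>x. F x * deriv \<phi> x \<partial>?M) = - (\<integral>x. f x * \<phi> x \<partial>?M)"
      by (rule integral_test_by_parts[OF assms(1) \<phi> F cf])
    moreover have "(\<integral>x. (A * g x + F x) * deriv \<phi> x \<partial>?M)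
        = (\<integral>x. A * (g x * deriv \<phi> x) + F x * deriv \<phi> x \<partial>?M)"
      by (simp add: algebra_simps)
    moreover have "\<dots> = A * (\<integral>x. g x * deriv \<phi> x \<partial>?M) + (\<integral>x. F x * deriv \<phi> x \<partial>?M)"
      using L2_space_mult_integrable[OF gL2 L2_space_continuous[OF c(2)]]
        L2_space_mult_integrable[OF L2_space_continuous[OF cF] L2_space_continuous[OF c(2)]] by simp
    ultimately show ?thesis by simp
  qed
  then obtain c where c: "AE x in ?M. A * g x + F x = c"
    using du_Bois_Reymond[OF assms(1) hL2] by blast
  define W where "W x = (c - F x) / A" for x
  have gW: "AE x in ?M. g x = W x"
    using c by eventually_elim (use A_pos in \<open>auto simp: W_def field_simps\<close>)
  have cW: "continuous_on {p..q} W" unfolding W_def using A_pos by (intro continuous_intros cF) auto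
  note [measurable] = meas[OF cW]
  \<comment> \<open>Exchanging g for \<open>W\<close> under the integral exhibits \<open>U\<close>
    as a primitive of a continuous function, so U' = W holds at every point and not just almost
    everywhere.\<close>
  have UW: "U x = integral {p..x} W" if "x \<in> {p..q}" for x
  proof -
    have "U x = (\<integral>t. indicator {..x} t * W t \<partial>?M)"
      unfolding U(5)[OF that]
      by (rule integral_cong_AE)
         (use gW L2_space_indicator_atMost[OF gL2] L2_space_indicator_atMost[OF L2_space_continuous[OF cW]]
           in \<open>auto elim!: eventually_mono\<close>)
    then show ?thesis using integral_indicator_atMost[OF cW that] by simp
  qed
  have "dirichlet_solution p q (\<lambda>x. (l - b * (U x)\<^sup>2) / A) U W"
    unfolding dirichlet_solution_def
  proof (intro conjI ballI U)
    fix x assume x: "x \<in> {p..q}"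
    show "(U has_real_derivative W x) (at x within {p..q})"
      using integral_has_real_derivative[OF cW x] zero_less_one x
      by (rule has_field_derivative_transform_within) (simp add: UW)
    have "(W has_real_derivative - f x / A) (at x within {p..q})"
      unfolding W_def using F[OF x] A_pos by (auto intro!: derivative_eq_intros)
    then show "(W has_real_derivative - ((l - b * (U x)\<^sup>2) / A * U x)) (at x within {p..q})"
      by (simp add: f_def power2_eq_square power3_eq_cube algebra_simps diff_divide_distrib)
  qed
  moreover have "deriv_norm_sq ?S u = (\<integral>x. (W x)\<^sup>2 \<partial>?M)"
    unfolding deriv_norm_sq_def g_def[symmetric]
    by (rule integral_cong_AE) (use gW in \<open>auto elim!: eventually_mono\<close>)
  moreover have "\<dots> = integral {p..q} (\<lambda>x. (W x)\<^sup>2)"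
    by (intro integral_Ioo continuous_intros cW)
  ultimately show ?thesis by (intro that[of U W, folded A_def] U(4)) simp_all
qed

subsection \<open>Positivity and Picone's inequality\<close>

text \<open>A Gronwall argument for E = U^2 + U'^2. Here E' = 2 U U' (1 - r), and 2 |U U'| \<le> E
  together with |1 - r| \<le> 1 + K gives |E'| \<le> C E for C = 1 + K. Thus E exp(-C t) does not
  increase to the right of \<open>z\<close> and E exp(C t) does not decrease up to \<open>z\<close>
  from the left; both vanish at \<open>z\<close>.\<close>

lemma linear_ode_zero:
  fixes U U' r :: "real \<Rightarrow> real"
  assumes U: "\<And>x. x \<in> {p..q} \<Longrightarrow> (U has_real_derivative U' x) (at x within {p..q})"
    and U': "\<And>x. x \<in> {p..q} \<Longrightarrow> (U' has_real_derivative - (r x * U x)) (at x within {p..q})"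
    and r: "continuous_on {p..q} r"
    and z: "z \<in> {p..q}" "U z = 0" "U' z = 0" and x: "x \<in> {p..q}"
  shows "U x = 0"
proof -
  obtain K where K: "\<And>t. t \<in> {p..q} \<Longrightarrow> \<bar>r t\<bar> \<le> K"
    using compact_imp_bounded[OF compact_continuous_image[OF r compact_Icc]]
    unfolding bounded_iff by force
  define E where "E t = (U t)\<^sup>2 + (U' t)\<^sup>2" for t
  define C where "C = 1 + K"
  have c: "continuous_on {p..q} U" "continuous_on {p..q} U'"
    by (rule DERIV_continuous_on[OF U], assumption) (rule DERIV_continuous_on[OF U'])
  have dE: "(E has_real_derivative 2 * U t * U' t * (1 - r t)) (at t)" if "p < t" "t < q" for t
  proof -
    have "at t within {p..q} = at t" using that by (intro at_within_Icc_at)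
    then have "(U has_real_derivative U' t) (at t)" "(U' has_real_derivative - (r t * U t)) (at t)"
      using U[of t] U'[of t] that by auto
    then show ?thesis
      unfolding E_def by (auto intro!: derivative_eq_intros simp: algebra_simps)
  qed
  have bd: "\<bar>2 * U t * U' t * (1 - r t)\<bar> \<le> C * E t" if "t \<in> {p..q}" for t
  proof -
    have "\<bar>2 * U t * U' t\<bar> \<le> E t"
      using sum_squares_bound[of "\<bar>U t\<bar>" "\<bar>U' t\<bar>"] by (simp add: E_def abs_mult)
    moreover have "\<bar>1 - r t\<bar> \<le> C" using K[OF that] by (auto simp: C_def)
    ultimately show ?thesis
      unfolding abs_mult[of _ "1 - r t"] by (subst mult.commute) (intro mult_mono, auto)
  qed
  have "E x \<le> 0"
  proof (cases "z \<le> x")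
    case True
    have "E x * exp (- C * x) \<le> E z * exp (- C * z)"
    proof (rule DERIV_nonpos_imp_decreasing_open[OF True])
      fix t assume t: "z < t" "t < x"
      then have t': "p < t" "t < q" using z x by auto
      have "((\<lambda>t. E t * exp (- C * t)) has_real_derivative
          (2 * U t * U' t * (1 - r t) - C * E t) * exp (- C * t)) (at t)"
        using dE[OF t'] by (auto intro!: derivative_eq_intros simp: algebra_simps)
      moreover have "(2 * U t * U' t * (1 - r t) - C * E t) * exp (- C * t) \<le> 0"
        using bd[of t] t' by (intro mult_nonpos_nonneg) auto
      ultimately show "\<exists>y. ((\<lambda>t. E t * exp (- C * t)) has_real_derivative y) (at t) \<and> y \<le> 0" by blast
    next
      have "{z..x} \<subseteq> {p..q}" using z x by auto
      then show "continuous_on {z..x} (\<lambda>t. E t * exp (- C * t))"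
        unfolding E_def by (intro continuous_intros continuous_on_subset[OF c(1)] continuous_on_subset[OF c(2)])
    qed
    then show ?thesis using z by (simp add: E_def mult_le_0_iff)
  next
    case False
    have "E x * exp (C * x) \<le> E z * exp (C * z)"
    proof (rule DERIV_nonneg_imp_increasing_open[of x z "\<lambda>t. E t * exp (C * t)"])
      show "x \<le> z" using False by simp
      fix t assume t: "x < t" "t < z"
      then have t': "p < t" "t < q" using z x by auto
      have "((\<lambda>t. E t * exp (C * t)) has_real_derivative
          (2 * U t * U' t * (1 - r t) + C * E t) * exp (C * t)) (at t)"
        using dE[OF t'] by (auto intro!: derivative_eq_intros simp: algebra_simps)
      moreover have "(2 * U t * U' t * (1 - r t) + C * E t) * exp (C * t) \<ge> 0"
        using bd[of t] t' by (intro mult_nonneg_nonneg) auto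
      ultimately show "\<exists>y. ((\<lambda>t. E t * exp (C * t)) has_real_derivative y) (at t) \<and> 0 \<le> y" by blast
    next
      have "{x..z} \<subseteq> {p..q}" using z x by auto
      then show "continuous_on {x..z} (\<lambda>t. E t * exp (C * t))"
        unfolding E_def by (intro continuous_intros continuous_on_subset[OF c(1)] continuous_on_subset[OF c(2)])
    qed
    then show ?thesis using z by (simp add: E_def mult_le_0_iff)
  qed
  then show ?thesis by (simp add: E_def sum_power2_le_zero_iff)
qed

text \<open>An interior zero of a nonnegative function is a local minimum, so U' vanishes there as
  well and \<open>linear_ode_zero\<close> carries the zero over to \<open>y\<close>.\<close>

lemma dirichlet_solution_pos:
  assumes sol: "dirichlet_solution p q f U U'" and f: "continuous_on {p..q} f"
    and nonneg: "\<And>x. x \<in> {p..q} \<Longrightarrow> U x \<ge> 0"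
    and y: "y \<in> {p..q}" "U y \<noteq> 0" and x: "x \<in> {p<..<q}"
  shows "U x > 0"
proof (rule ccontr)
  assume "\<not> U x > 0"
  then have "U x = 0" using nonneg[of x] x by auto
  have "(U has_real_derivative U' x) (at x)"
    using sol x at_within_Icc_at[of p x q] by (auto simp: dirichlet_solution_def dest: bspec[of _ _ x])
  then have "U' x = 0"
  proof (rule DERIV_local_min)
    show "0 < min (x - p) (q - x)" using x by auto
    show "\<forall>t. \<bar>x - t\<bar> < min (x - p) (q - x) \<longrightarrow> U x \<le> U t"
    proof (intro allI impI)
      fix t assume "\<bar>x - t\<bar> < min (x - p) (q - x)"
      then have "t \<in> {p..q}" unfolding atLeastAtMost_iff by linarith
      then show "U x \<le> U t" using nonneg \<open>U x = 0\<close> by simp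
    qed
  qed
  then have "U y = 0"
    using sol f x y \<open>U x = 0\<close> linear_ode_zero[of p q U U' f x y] by (auto simp: dirichlet_solution_def)
  with y show False by simp
qed

text \<open>Pointwise \<open>U' (V\<^sup>2 / (U + \<epsilon>))' = V'\<^sup>2 - (V' - V U' / (U + \<epsilon>))\<^sup>2\<close>; the shift by \<open>\<epsilon>\<close> makes
  the test function \<open>V\<^sup>2 / (U + \<epsilon>)\<close> differentiable at the end points, where \<open>U\<close> vanishes.\<close>

lemma picone_inequality:
  assumes "p < q" and sol: "dirichlet_solution p q f U U'" and f: "continuous_on {p..q} f"
    and pos: "\<And>x. x \<in> {p<..<q} \<Longrightarrow> U x > 0"
    and V: "\<And>x. x \<in> {p..q} \<Longrightarrow> (V has_real_derivative V' x) (at x within {p..q})"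
    and cV': "continuous_on {p..q} V'" and V0: "V p = 0" "V q = 0"
  shows "integral {p..q} (\<lambda>x. f x * (V x)\<^sup>2) \<le> integral {p..q} (\<lambda>x. (V' x)\<^sup>2)"
proof -
  note cU = dirichlet_solution_continuous[OF sol]
  have cV: "continuous_on {p..q} V" using V by (blast intro: DERIV_continuous_on)
  have U0: "U p = 0" "U q = 0" and
    U: "\<And>x. x \<in> {p..q} \<Longrightarrow> (U has_real_derivative U' x) (at x within {p..q})" and
    U': "\<And>x. x \<in> {p..q} \<Longrightarrow> (U' has_real_derivative - (f x * U x)) (at x within {p..q})"
    using sol by (auto simp: dirichlet_solution_def)
  have nonneg: "U x \<ge> 0" if "x \<in> {p..q}" for x
    using pos[of x] U0 that by (cases "x = p \<or> x = q") (auto intro: less_imp_le)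
  \<comment> \<open>Multiplying -U'' = f U by V^2 / (U + e) produces f V^2 with the extra factor U /
    (U + e), the price of the shift.\<close>
  have le: "integral {p..q} (\<lambda>x. f x * (V x)\<^sup>2 * (U x / (U x + e))) \<le> integral {p..q} (\<lambda>x. (V' x)\<^sup>2)"
    if e: "e > 0" for e
  proof -
    have ne: "U x + e \<noteq> 0" if "x \<in> {p..q}" for x using nonneg[OF that] e by simp
    define w' where "w' x = 2 * V x * V' x / (U x + e) - (V x)\<^sup>2 * U' x / (U x + e)\<^sup>2" for x
    have dw: "((\<lambda>x. (V x)\<^sup>2 / (U x + e)) has_real_derivative w' x) (at x within {p..q})"
      if "x \<in> {p..q}" for x
    proof -
      have "((\<lambda>x. (V x)\<^sup>2 / (U x + e)) has_real_derivative
          (2 * V x * V' x * (U x + e) - (V x)\<^sup>2 * U' x) / ((U x + e) * (U x + e))) (at x within {p..q})"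
        by (intro DERIV_divide ne that) (auto intro!: derivative_eq_intros V U that)
      moreover have "(2 * V x * V' x * (U x + e) - (V x)\<^sup>2 * U' x) / ((U x + e) * (U x + e)) = w' x"
        using ne[OF that] by (simp add: w'_def diff_divide_distrib power2_eq_square[of "U x + e"])
      ultimately show ?thesis by simp
    qed
    have cw: "continuous_on {p..q} w'"
      unfolding w'_def by (intro continuous_intros cU cV cV') (auto simp: ne)
    have "integral {p..q} (\<lambda>x. f x * (V x)\<^sup>2 * (U x / (U x + e)))
      = - integral {p..q} (\<lambda>x. (V x)\<^sup>2 / (U x + e) * - (f x * U x))"
      unfolding Henstock_Kurzweil_Integration.integral_neg[symmetric] by (simp add: mult_ac)
    also have "integral {p..q} (\<lambda>x. (V x)\<^sup>2 / (U x + e) * - (f x * U x))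
      = - integral {p..q} (\<lambda>x. w' x * U' x)"
      using assms(1) V0
      by (intro integral_by_parts_vanishing dw U' cw) (auto intro!: continuous_intros f cU)
    also have "- (- integral {p..q} (\<lambda>x. w' x * U' x)) \<le> integral {p..q} (\<lambda>x. (V' x)\<^sup>2)"
      unfolding minus_minus
    proof (rule integral_le)
      show "(\<lambda>x. w' x * U' x) integrable_on {p..q}" "(\<lambda>x. (V' x)\<^sup>2) integrable_on {p..q}"
        by (intro integrable_continuous_real continuous_intros cw cU cV')+
      fix x assume x: "x \<in> {p..q}"
      have "w' x * U' x = (V' x)\<^sup>2 - (V' x - V x * U' x / (U x + e))\<^sup>2"
      proof -
        define t where "t = inverse (U x + e)"
        have w: "w' x = 2 * V x * V' x * t - (V x)\<^sup>2 * U' x * t\<^sup>2"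
          by (simp add: w'_def t_def divide_inverse power_inverse)
        have quot: "V x * U' x / (U x + e) = V x * U' x * t" by (simp add: t_def divide_inverse)
        show ?thesis unfolding w quot by (simp add: power2_eq_square algebra_simps)
      qed
      then show "w' x * U' x \<le> (V' x)\<^sup>2" by simp
    qed
    finally show ?thesis .
  qed
  \<comment> \<open>The shift is removed along e = 1 / (n + 1). The factor U / (U + e) lies in
    [0, 1] and tends to 1 in the interior; at the end points it is 0, but there V = 0 makes the
    limit correct.\<close>
  define X where "X n x = f x * (V x)\<^sup>2 * (U x / (U x + 1 / Suc n))" for n :: nat and x
  have "(\<lambda>n. integral {p..q} (X n)) \<longlonglongrightarrow> integral {p..q} (\<lambda>x. f x * (V x)\<^sup>2)"
  proof (rule dominated_convergence(2))
    have "U x + 1 / Suc n \<noteq> 0" if "x \<in> {p..q}" for n x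
      using nonneg[OF that] by (simp add: add_nonneg_eq_0_iff)
    then show "X n integrable_on {p..q}" for n
      unfolding X_def by (intro integrable_continuous_real continuous_intros f cU cV) auto
    show "(\<lambda>x. \<bar>f x * (V x)\<^sup>2\<bar>) integrable_on {p..q}"
      by (intro integrable_continuous_real continuous_intros f cV)
    show "norm (X n x) \<le> \<bar>f x * (V x)\<^sup>2\<bar>" if "x \<in> {p..q}" for n x
    proof -
      have "U x / (U x + 1 / Suc n) \<le> 1" "U x / (U x + 1 / Suc n) \<ge> 0"
        using nonneg[OF that] by (auto simp: divide_le_eq_1 add_nonneg_pos)
      then have "\<bar>U x / (U x + 1 / Suc n)\<bar> \<le> 1" by linarith
      then show ?thesis
        unfolding X_def real_norm_def abs_mult[of _ "U x / _"] by (rule mult_left_le[OF _ abs_ge_zero])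
    qed
    show "(\<lambda>n. X n x) \<longlonglongrightarrow> f x * (V x)\<^sup>2" if x: "x \<in> {p..q}" for x
    proof (cases "x = p \<or> x = q")
      case True
      then show ?thesis using V0 by (auto simp: X_def)
    next
      case False
      then have "U x > 0" using x by (intro pos) auto
      then have "(\<lambda>n. X n x) \<longlonglongrightarrow> f x * (V x)\<^sup>2 * (U x / (U x + 0))"
        unfolding X_def by (intro tendsto_intros LIMSEQ_Suc[OF lim_1_over_n]) auto
      then show ?thesis using \<open>U x > 0\<close> by simp
    qed
  qed
  moreover have "integral {p..q} (X n) \<le> integral {p..q} (\<lambda>x. (V' x)\<^sup>2)" for n
    unfolding X_def[abs_def] by (rule le) simp
  ultimately show ?thesis by (intro LIMSEQ_le_const2) auto
qed

section \<open>Energy comparison of two solutions\<close>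

lemma dirichlet_solution_energy:
  assumes "p \<le> q" and sol: "dirichlet_solution p q f U U'" and f: "continuous_on {p..q} f"
  shows "integral {p..q} (\<lambda>x. f x * (U x)\<^sup>2) = integral {p..q} (\<lambda>x. (U' x)\<^sup>2)"
proof -
  note c = dirichlet_solution_continuous[OF sol]
  have "integral {p..q} (\<lambda>x. U x * - (f x * U x)) = - integral {p..q} (\<lambda>x. U' x * U' x)"
    using assms(1) sol
    by (intro integral_by_parts_vanishing)
       (auto simp: dirichlet_solution_def intro!: continuous_intros c f)
  moreover have "integral {p..q} (\<lambda>x. U x * - (f x * U x)) = - integral {p..q} (\<lambda>x. f x * (U x)\<^sup>2)"
    unfolding Henstock_Kurzweil_Integration.integral_neg[symmetric]
    by (rule integral_cong) (simp add: power2_eq_square)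
  ultimately show ?thesis unfolding power2_eq_square by linarith
qed

text \<open>For the coefficient of \<open>U\<close>, the energy identity is an equality when tested
  with U^2, and Picone's inequality bounds the integral against V^2. Subtracting and multiplying by
  A > 0 clears the denominator. The coefficient \<open>f\<close> of \<open>V\<close> is kept general
  because the other solution carries its own constant in place of \<open>A\<close>.\<close>

lemma picone_difference:
  assumes "p < q" "A > 0"
    and U: "dirichlet_solution p q (\<lambda>x. (l - b * (U x)\<^sup>2) / A) U U'"
    and pos: "\<And>x. x \<in> {p<..<q} \<Longrightarrow> U x > 0"
    and V: "dirichlet_solution p q f V V'"
  shows "A * (integral {p..q} (\<lambda>x. (U' x)\<^sup>2) - integral {p..q} (\<lambda>x. (V' x)\<^sup>2))
    \<le> integral {p..q} (\<lambda>x. (l - b * (U x)\<^sup>2) * ((U x)\<^sup>2 - (V x)\<^sup>2))"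
proof -
  note cU = dirichlet_solution_continuous[OF U] and cV = dirichlet_solution_continuous[OF V]
  let ?r = "\<lambda>x. (l - b * (U x)\<^sup>2) / A"
  have r: "continuous_on {p..q} ?r" using assms(2) by (intro continuous_intros cU) auto
  have "integral {p..q} (\<lambda>x. ?r x * (U x)\<^sup>2) = integral {p..q} (\<lambda>x. (U' x)\<^sup>2)"
    using assms(1) by (intro dirichlet_solution_energy[OF _ U r]) auto
  moreover have "integral {p..q} (\<lambda>x. ?r x * (V x)\<^sup>2) \<le> integral {p..q} (\<lambda>x. (V' x)\<^sup>2)"
    using V by (intro picone_inequality[OF assms(1) U r pos _ cV(2)]) (auto simp: dirichlet_solution_def)
  moreover have "integral {p..q} (\<lambda>x. ?r x * (U x)\<^sup>2 - ?r x * (V x)\<^sup>2)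
      = integral {p..q} (\<lambda>x. ?r x * (U x)\<^sup>2) - integral {p..q} (\<lambda>x. ?r x * (V x)\<^sup>2)"
    by (intro Henstock_Kurzweil_Integration.integral_diff integrable_continuous_real continuous_intros r cU cV)
      (use assms(2) in auto)
  ultimately have "integral {p..q} (\<lambda>x. (U' x)\<^sup>2) - integral {p..q} (\<lambda>x. (V' x)\<^sup>2)
      \<le> integral {p..q} (\<lambda>x. ?r x * (U x)\<^sup>2 - ?r x * (V x)\<^sup>2)"
    by linarith
  then have "A * (integral {p..q} (\<lambda>x. (U' x)\<^sup>2) - integral {p..q} (\<lambda>x. (V' x)\<^sup>2))
      \<le> A * integral {p..q} (\<lambda>x. ?r x * (U x)\<^sup>2 - ?r x * (V x)\<^sup>2)"
    using assms(2) by simp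
  also have "\<dots> = integral {p..q} (\<lambda>x. A * (?r x * (U x)\<^sup>2 - ?r x * (V x)\<^sup>2))"
    by simp
  also have "(\<lambda>x. A * (?r x * (U x)\<^sup>2 - ?r x * (V x)\<^sup>2)) = (\<lambda>x. (l - b * (U x)\<^sup>2) * ((U x)\<^sup>2 - (V x)\<^sup>2))"
    using assms(2) by (auto simp: right_diff_distrib)
  finally show ?thesis .
qed

lemma positive_weak_solution_regular:
  assumes "p < q" and sol: "weak_solution {p<..<q} a l b u"
    and A: "a (deriv_norm_sq {p<..<q} u) > 0"
    and "positive_fun {p<..<q} u" "nontrivial_fun {p<..<q} u"
  obtains U U' where
    "dirichlet_solution p q (\<lambda>x. (l - b * (U x)\<^sup>2) / a (deriv_norm_sq {p<..<q} u)) U U'"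
    "\<And>x. x \<in> {p<..<q} \<Longrightarrow> U x > 0"
    "AE x in lebesgue_on {p<..<q}. u x = U x"
    "deriv_norm_sq {p<..<q} u = integral {p..q} (\<lambda>x. (U' x)\<^sup>2)"
proof -
  let ?M = "lebesgue_on {p<..<q}"
  obtain U U' where U:
    "dirichlet_solution p q (\<lambda>x. (l - b * (U x)\<^sup>2) / a (deriv_norm_sq {p<..<q} u)) U U'"
    "AE x in ?M. u x = U x"
    "deriv_norm_sq {p<..<q} u = integral {p..q} (\<lambda>x. (U' x)\<^sup>2)"
    using weak_solution_regular[OF assms(1) sol A] by blast
  note c = dirichlet_solution_continuous[OF U(1)]
  have "AE x in ?M. U x \<ge> 0"
    using U(2) assms(4) unfolding positive_fun_def by eventually_elim auto
  then have ae: "AE x in lebesgue. x \<in> {p<..<q} \<longrightarrow> U x \<ge> 0"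
    by (subst (asm) AE_restrict_space_iff) auto
  have nonneg: "U x \<ge> 0" if x: "x \<in> {p..q}" for x
  proof -
    \<comment> \<open>The sign of u is known only almost everywhere. By continuity the set where U
      \<ge> 0 is closed, and a closed set containing almost every point of an open interval contains
      all of it.\<close>
    have cl: "closed ({p..q} \<inter> U -` {0..})"
      by (intro continuous_closed_preimage c closed_atLeast closed_atLeastAtMost)
    have "AE x \<in> {p<..<q} in lebesgue. x \<in> {p..q} \<inter> U -` {0..}"
      using ae by eventually_elim auto
    from mem_closed_if_AE_lebesgue_open[OF open_greaterThanLessThan cl this]
    have "U x \<ge> 0" if "x \<in> {p<..<q}" for x
      using that by blast
    then show ?thesis
      using U(1) x by (cases "x = p \<or> x = q") (auto simp: dirichlet_solution_def)
  qed
  have "\<exists>y\<in>{p..q}. U y \<noteq> 0"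
  proof (rule ccontr)
    assume "\<not> ?thesis"
    then have "AE x in ?M. U x = 0" by (intro AE_I2) auto
    with U(2) have "AE x in ?M. u x = 0" by eventually_elim simp
    then show False using assms(5) by (simp add: nontrivial_fun_def)
  qed
  then have "U x > 0" if "x \<in> {p<..<q}" for x
    using A that by (auto intro!: dirichlet_solution_pos[OF U(1) _ nonneg] continuous_intros c)
  then show ?thesis using that U by blast
qed

theorem lemma4p2:
  fixes a :: "real \<Rightarrow> real" and \<sigma> l b :: real and j :: nat and u v :: "real \<Rightarrow> real"
  assumes "continuous_on UNIV a" and "mono a"
    and "\<sigma> > 0" and "\<And>t. \<sigma> \<le> a t"
    and "l > 0" and "b > 0" and "j \<ge> 1"
    and "weak_solution {0<..<pi / real j} a l b u"
    and "positive_fun {0<..<pi / real j} u" and "nontrivial_fun {0<..<pi / real j} u"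
    and "weak_solution {0<..<pi / real j} a l b v"
    and "positive_fun {0<..<pi / real j} v" and "nontrivial_fun {0<..<pi / real j} v"
  shows "AE x in lebesgue_on {0<..<pi / real j}. u x = v x"
proof -
  define q where "q = pi / real j"
  have q: "0 < q" using assms(7) by (simp add: q_def)
  let ?M = "lebesgue_on {0<..<q}"
  define m n where "m = deriv_norm_sq {0<..<q} u" and "n = deriv_norm_sq {0<..<q} v"
  have a_pos: "a t > 0" for t using assms(3,4) less_le_trans by blast
  obtain U U' where U: "dirichlet_solution 0 q (\<lambda>x. (l - b * (U x)\<^sup>2) / a m) U U'"
    "\<And>x. x \<in> {0<..<q} \<Longrightarrow> U x > 0" "AE x in ?M. u x = U x" "m = integral {0..q} (\<lambda>x. (U' x)\<^sup>2)"
    using positive_weak_solution_regular[OF q assms(8)[folded q_def] a_pos assms(9,10)[folded q_def]]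
    unfolding m_def by blast
  obtain V V' where V: "dirichlet_solution 0 q (\<lambda>x. (l - b * (V x)\<^sup>2) / a n) V V'"
    "\<And>x. x \<in> {0<..<q} \<Longrightarrow> V x > 0" "AE x in ?M. v x = V x" "n = integral {0..q} (\<lambda>x. (V' x)\<^sup>2)"
    using positive_weak_solution_regular[OF q assms(11)[folded q_def] a_pos assms(12,13)[folded q_def]]
    unfolding n_def by blast
  note c = dirichlet_solution_continuous(1)[OF U(1)] dirichlet_solution_continuous(1)[OF V(1)]
  let ?D = "\<lambda>x. ((U x)\<^sup>2 - (V x)\<^sup>2)\<^sup>2"
  have "0 \<le> (a m - a n) * (m - n)"
    using monoD[OF assms(2), of m n] monoD[OF assms(2), of n m]
    by (cases "m \<le> n") (auto intro: mult_nonpos_nonpos)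
  also have "\<dots> = a m * (m - n) + a n * (n - m)" by (simp add: algebra_simps)
  \<comment> \<open>The nonlocal quantities m and n are the classical energies of \<open>U\<close>
    and \<open>V\<close>, so both instances of \<open>picone_difference\<close> apply, each with its
    own positive constant.\<close>
  also have "\<dots> \<le> integral {0..q} (\<lambda>x. (l - b * (U x)\<^sup>2) * ((U x)\<^sup>2 - (V x)\<^sup>2))
      + integral {0..q} (\<lambda>x. (l - b * (V x)\<^sup>2) * ((V x)\<^sup>2 - (U x)\<^sup>2))"
    using picone_difference[OF q a_pos U(1,2) V(1)] picone_difference[OF q a_pos V(1,2) U(1)]
    unfolding U(4)[symmetric] V(4)[symmetric] by (intro add_mono) auto
  also have "\<dots> = integral {0..q} (\<lambda>x. (l - b * (U x)\<^sup>2) * ((U x)\<^sup>2 - (V x)\<^sup>2)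
      + (l - b * (V x)\<^sup>2) * ((V x)\<^sup>2 - (U x)\<^sup>2))"
    by (intro Henstock_Kurzweil_Integration.integral_add[symmetric] integrable_continuous_real continuous_intros c)
  also have "\<dots> = integral {0..q} (\<lambda>x. - b * ?D x)"
    by (rule integral_cong) (simp add: power2_eq_square algebra_simps)
  also have "\<dots> = - b * integral {0..q} ?D" by simp
  finally have "integral {0..q} ?D \<le> 0" using assms(6) by (simp add: mult_le_0_iff)
  moreover have "integral {0..q} ?D \<ge> 0"
    by (intro integral_nonneg integrable_continuous_real continuous_intros c) auto
  ultimately have "\<forall>x\<in>{0..q}. ?D x = 0"
    using q by (subst integral_eq_0_iff[symmetric]) (auto intro!: continuous_intros c)
  then have UV: "U x = V x" if "x \<in> {0<..<q}" for x
    using that U(2)[OF that] V(2)[OF that] by (auto simp: power2_eq_iff)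
  have "AE x in ?M. x \<in> {0<..<q}" by (rule AE_I2) simp
  with U(3) V(3) have "AE x in ?M. u x = v x"
    by eventually_elim (simp add: UV)
  then show ?thesis unfolding q_def .
qed

end
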